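(* Let $p$ be a prime and let $G=\Delta(p,q,r)=\langle x,y\mid x^p=y^q=(xy)^r=1\rangle$. Let $\pi$ be a permutation representation of $G$ on a finite set $\Omega$ of size $n$, and let $\pi_1,\dots,\pi_p$ be transitive permutation representations of $G$ on pairwise disjoint finite sets $\Omega_1,\dots,\Omega_p$, where each $\pi_i$ is equivalent to $\pi$ via a bijection $f_i:\Omega\to\Omega_i$, i.e. $f_i(\omega^{\pi(g)})=f_i(\omega)^{\pi_i(g)}$ for all $\omega\in\Omega$, $g\in G$. Let $[a,b]_k$ be a $k$-handle of $\pi$ (for some $k$), and put $a_i=f_i(a)$, $b_i=f_i(b)$, so that $[a_i,b_i]_k$ is a $k$-handle of $\pi_i$. Let $\mathcal U=\Omega_1\cup\dots\cup\Omega_p$ and let $\phi:G\to\mathcal S(\mathcal U)$ be the permutation representation with $$\phi(x)=\pi_1(x)\cdots\pi_p(x)\circ(a_1,a_2,\dots,a_p)(b_p,b_{p-1},\dots,b_1),\qquad \phi(y)=\pi_1(y)\cdots\pi_p(y).$$ For $\omega\in\Omega$ let $B_\omega=\{f_i(\omega): i=1,\dots,p\}\subseteq\mathcal U$, let $\mathcal B=\{B_\omega:\omega\in\Omega\}$, and let $H=\phi(G)$. Then: (i) $H$ acts on $\mathcal B$, and this action $\psi$ is equivalent to the action of $\pi(G)$ on $\Omega$. (ii) $H$ acts imprimitively on $\mathcal U$, with the sets $B_\omega$ as blocks of imprimitivity. (iii) With $N,J_\omega,K_\omega,Q_\omega$ and $Q$ as defined in the context, $Q$ is cyclic of order $p$,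 and $N$ is elementary abelian of order at most $p^n$. (iv) $H$ is isomorphic to a subgroup of $C_p\wr\psi(H)$; the action of $H$ on $N$ by conjugation induces an action of $\psi(H)$ on $N$; and under this action $N$ is (isomorphic to) a submodule of the $n$-dimensional permutation module over $\mathbb F_p$ for $\psi(H)$, regarded as a subgroup of $\mathcal S(\Omega)$.
   Context: $\mathcal S(X)$ is the group of all permutations of a set $X$; permutations act on the right, $\omega^{g}$ is the image of $\omega$ under $g$, and products are composed left to right. For a permutation representation $\pi$ of $G=\Delta(p,q,r)$, a $k$-handle $[a,b]_k$ consists of two distinct points $a,b$, both fixed by $\pi(x)$, such that $(\pi(x)\pi(y))^k$ maps $a$ to $b$. In the union $\mathcal U$, each $\pi_i(g)$ is regarded as a permutation of $\mathcal U$ acting on $\Omega_i$ and fixing the remaining points. The permutations $\phi(x),\phi(y)$ satisfy the defining relations of $G$, and $\phi$ is the resulting transitive permutation representation of $G$ on $\mathcal U$ (the "composition" of $\pi_1,\dots,\pi_p$ along the handles). A block for a permutation group $H$ on $\mathcal U$ is a subset $X\subseteq\mathcal U$ such that for each $h\in H$ either $X^h=X$ or $X^h\cap X=\emptyset$; a block system is a partition of $\mathcal U$ into blocks permuted by $H$. Equivalence of the action of $\phi(G)$ on $\mathcal B$ with the action of $\pi(G)$ on $\Omega$ means that there is a bijection $F:\Omega\to\mathcal B$ with $F(\omega^{\pi(g)})=F(\omega)^{\phi(g)}$ for all $\omega\in\Omega$, $g\in G$; through it $\psi(H)$ is regarded as a subgroup of $\mathcal S(\Omega)$. For the block system $\mathcal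 B=\{B_\omega\}$: $J_\omega$ and $K_\omega$ are the setwise and pointwise stabilisers of $B_\omega$ in $H$; $\psi:H\to\mathcal S(\mathcal B)$ is the action on blocks; $N=\ker\psi=\bigcap_\omega J_\omega$; $Q_\omega\subseteq\mathcal S(\mathcal U)$ is the group of permutations induced on $B_\omega$ by $J_\omega$, extended to fix all points of $\mathcal U\setminus B_\omega$ (so $Q_\omega\cong J_\omega/K_\omega$). The groups $Q_\omega$ are all isomorphic to one group, denoted $Q$. $C_p$ is the cyclic group of order $p$, and for $P\le\mathcal S(\Omega)$ with $|\Omega|=n$, $C_p\wr P=C_p^{\,n}\rtimes P$ with $P$ permuting the factors. *)

theory Defs
  imports
    "HOL-Algebra.Algebra"
    "HOL-Combinatorics.Cycles"
    "HOL-Number_Theory.Residues"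
    "HOL-Library.Disjoint_Sets"
begin

section \<open>Groups given by generators and relators\<close>

text \<open>Words over the letters \<open>(g, True)\<close>, standing for \<open>g\<close>, and \<open>(g, False)\<close>, standing for
  the inverse of \<open>g\<close>.\<close>

inductive pres_eq :: "('g \<times> bool) list set \<Rightarrow> ('g \<times> bool) list \<Rightarrow> ('g \<times> bool) list \<Rightarrow> bool"
  for R where
  refl: "pres_eq R u u"
| sym: "pres_eq R u v \<Longrightarrow> pres_eq R v u"
| trans: "pres_eq R u v \<Longrightarrow> pres_eq R v w \<Longrightarrow> pres_eq R u w"
| append: "pres_eq R u u' \<Longrightarrow> pres_eq R v v' \<Longrightarrow> pres_eq R (u @ v) (u' @ v')"
| cancel: "pres_eq R [(g, e), (g, \<not> e)] []"
| relator: "w \<in> R \<Longrightarrow> pres_eq R w []"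

definition pres_class :: "('g \<times> bool) list set \<Rightarrow> ('g \<times> bool) list \<Rightarrow> ('g \<times> bool) list set" where
  "pres_class R w = {v. pres_eq R w v}"

definition presented_group :: "('g \<times> bool) list set \<Rightarrow> ('g \<times> bool) list set monoid" where
  "presented_group R =
     \<lparr>carrier = range (pres_class R),
      monoid.mult = (\<lambda>A B. \<Union>u\<in>A. \<Union>v\<in>B. pres_class R (u @ v)),
      one = pres_class R []\<rparr>"

lemma pres_class_eq_iff: "pres_class R u = pres_class R v \<longleftrightarrow> pres_eq R u v"
proof
  assume "pres_class R u = pres_class R v"
  then show "pres_eq R u v"
    using pres_eq.refl[of R v] by (auto simp: pres_class_def)
next
  assume "pres_eq R u v"
  then show "pres_class R u = pres_class R v"
    unfolding pres_class_def
    by (intro Collect_cong iffI) (erule pres_eq.trans[OF pres_eq.sym] pres_eq.trans, assumption)+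
qed

lemma pres_class_mult:
  "pres_class R u \<otimes>\<^bsub>presented_group R\<^esub> pres_class R v = pres_class R (u @ v)"
proof -
  have "pres_class R (u' @ v') = pres_class R (u @ v)"
    if "u' \<in> pres_class R u" "v' \<in> pres_class R v" for u' v'
    using that pres_eq.append[THEN pres_eq.sym] by (simp add: pres_class_eq_iff) (simp add: pres_class_def)
  moreover have "u \<in> pres_class R u" "v \<in> pres_class R v"
    by (simp_all add: pres_class_def pres_eq.refl)
  ultimately have "(\<Union>u'\<in>pres_class R u. \<Union>v'\<in>pres_class R v. pres_class R (u' @ v')) = pres_class R (u @ v)"
    by blast
  then show ?thesis
    by (simp add: presented_group_def)
qed

lemma group_presented_group: "group (presented_group R)"
proof -
  have carrier: "carrier (presented_group R) = range (pres_class R)"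
    and one: "\<one>\<^bsub>presented_group R\<^esub> = pres_class R []"
    by (simp_all add: presented_group_def)
  have "\<exists>v. pres_eq R (v @ u) []" for u
  proof (induction u)
    case Nil
    have "pres_eq R ([] @ []) []"
      using pres_eq.refl by simp
    then show ?case by blast
  next
    case (Cons l u)
    then obtain v where v: "pres_eq R (v @ u) []" by blast
    obtain g e where l: "l = (g, e)" by (cases l)
    have "pres_eq R [(g, \<not> e), (g, e)] []"
      using pres_eq.cancel[of R g "\<not> e"] by simp
    then have "pres_eq R (v @ ([(g, \<not> e), (g, e)] @ u)) (v @ ([] @ u))"
      by (intro pres_eq.append pres_eq.refl)
    then have "pres_eq R ((v @ [(g, \<not> e)]) @ l # u) (v @ u)"
      by (simp add: l)
    then have "pres_eq R ((v @ [(g, \<not> e)]) @ l # u) []"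
      using v by (rule pres_eq.trans)
    then show ?case by blast
  qed
  then have inverse: "\<exists>v. pres_class R (v @ u) = pres_class R []" for u
    by (simp add: pres_class_eq_iff)
  show ?thesis
    by (rule groupI) (auto simp: carrier one pres_class_mult inverse)
qed


section \<open>Triangle groups\<close>

datatype triangle_gen = Gen_x | Gen_y

definition triangle_relators :: "nat \<Rightarrow> nat \<Rightarrow> nat \<Rightarrow> (triangle_gen \<times> bool) list set" where
  "triangle_relators p q r =
     {replicate p (Gen_x, True),
      replicate q (Gen_y, True),
      concat (replicate r [(Gen_x, True), (Gen_y, True)])}"

definition triangle_group :: "nat \<Rightarrow> nat \<Rightarrow> nat \<Rightarrow> (triangle_gen \<times> bool) list set monoid" where
  "triangle_group p q r = presented_group (triangle_relators p q r)"

definition triangle_x :: "nat \<Rightarrow> nat \<Rightarrow> nat \<Rightarrow> (triangle_gen \<times> bool) list set" where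
  "triangle_x p q r = pres_class (triangle_relators p q r) [(Gen_x, True)]"

definition triangle_y :: "nat \<Rightarrow> nat \<Rightarrow> nat \<Rightarrow> (triangle_gen \<times> bool) list set" where
  "triangle_y p q r = pres_class (triangle_relators p q r) [(Gen_y, True)]"


section \<open>Permutation groups, acting on the right\<close>

text \<open>The product \<open>g \<otimes> h\<close> is ``first \<open>g\<close>, then \<open>h\<close>'', the opposite of the convention of
  \<^const>\<open>BijGroup\<close>. A permutation of \<open>S\<close> is a function on the whole type that fixes all points
  outside \<open>S\<close>, hence is at the same time a permutation of every larger set.\<close>

definition sym_grp :: "'a set \<Rightarrow> ('a \<Rightarrow> 'a) monoid" where
  "sym_grp S = \<lparr>carrier = {g. g permutes S}, monoid.mult = (\<lambda>g h. h \<circ> g), one = id\<rparr>"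

definition perm_grp :: "'a set \<Rightarrow> ('a \<Rightarrow> 'a) set \<Rightarrow> ('a \<Rightarrow> 'a) monoid" where
  "perm_grp S H = (sym_grp S)\<lparr>carrier := H\<rparr>"

lemma group_sym_grp: "group (sym_grp S)"
proof (rule groupI)
  fix g
  assume "g \<in> carrier (sym_grp S)"
  then have "g permutes S" by (simp add: sym_grp_def)
  then show "\<exists>h\<in>carrier (sym_grp S). h \<otimes>\<^bsub>sym_grp S\<^esub> g = \<one>\<^bsub>sym_grp S\<^esub>"
    by (intro bexI[of _ "inv_into UNIV g"])
       (auto simp: sym_grp_def permutes_inv permutes_inv_o)
qed (auto simp: sym_grp_def permutes_compose permutes_id comp_assoc)

definition perm_rep :: "('g, 'm) monoid_scheme \<Rightarrow> 'a set \<Rightarrow> ('g \<Rightarrow> 'a \<Rightarrow> 'a) \<Rightarrow> bool" where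
  "perm_rep G S \<rho> \<longleftrightarrow> \<rho> \<in> hom G (sym_grp S)"

definition equivalent_via ::
    "('g, 'm) monoid_scheme \<Rightarrow> 'a set \<Rightarrow> ('g \<Rightarrow> 'a \<Rightarrow> 'a) \<Rightarrow> 'b set \<Rightarrow> ('g \<Rightarrow> 'b \<Rightarrow> 'b) \<Rightarrow> ('a \<Rightarrow> 'b) \<Rightarrow> bool" where
  "equivalent_via G S \<rho> T \<sigma> F \<longleftrightarrow>
     bij_betw F S T \<and> (\<forall>\<omega>\<in>S. \<forall>g\<in>carrier G. F (\<rho> g \<omega>) = \<sigma> g (F \<omega>))"

definition transitive_on :: "('a \<Rightarrow> 'a) set \<Rightarrow> 'a set \<Rightarrow> bool" where
  "transitive_on H S \<longleftrightarrow> (\<forall>u\<in>S. \<forall>v\<in>S. \<exists>h\<in>H. h u = v)"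

definition is_block :: "('a \<Rightarrow> 'a) set \<Rightarrow> 'a set \<Rightarrow> 'a set \<Rightarrow> bool" where
  "is_block H U S \<longleftrightarrow> S \<subseteq> U \<and> (\<forall>h\<in>H. h ` S = S \<or> h ` S \<inter> S = {})"

definition block_system :: "('a \<Rightarrow> 'a) set \<Rightarrow> 'a set \<Rightarrow> 'a set set \<Rightarrow> bool" where
  "block_system H U \<B> \<longleftrightarrow>
     partition_on U \<B> \<and> (\<forall>S\<in>\<B>. is_block H U S) \<and> (\<forall>h\<in>H. \<forall>S\<in>\<B>. h ` S \<in> \<B>)"

definition imprimitive_with_blocks :: "('a \<Rightarrow> 'a) set \<Rightarrow> 'a set \<Rightarrow> 'a set set \<Rightarrow> bool" where
  "imprimitive_with_blocks H U \<B> \<longleftrightarrow>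
     transitive_on H U \<and> block_system H U \<B> \<and> (\<forall>S\<in>\<B>. S \<noteq> U \<and> \<not> is_singleton S)"

definition setwise_stab :: "('a \<Rightarrow> 'a) set \<Rightarrow> 'a set \<Rightarrow> ('a \<Rightarrow> 'a) set" where
  "setwise_stab H S = {h \<in> H. h ` S = S}"

definition induced_perms :: "('a \<Rightarrow> 'a) set \<Rightarrow> 'a set \<Rightarrow> ('a \<Rightarrow> 'a) set" where
  "induced_perms J S = (\<lambda>h u. if u \<in> S then h u else u) ` J"

definition block_action :: "'a set set \<Rightarrow> ('a \<Rightarrow> 'a) \<Rightarrow> 'a set \<Rightarrow> 'a set" where
  "block_action \<B> h = (\<lambda>S. if S \<in> \<B> then h ` S else S)"

text \<open>The permutation of \<open>S\<close> that corresponds to a permutation \<open>s\<close> of \<open>T\<close> under a bijection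
  \<open>F\<close> from \<open>S\<close> to \<open>T\<close>.\<close>

definition pullback_perm :: "'a set \<Rightarrow> ('a \<Rightarrow> 'b) \<Rightarrow> ('b \<Rightarrow> 'b) \<Rightarrow> 'a \<Rightarrow> 'a" where
  "pullback_perm S F s = (\<lambda>\<omega>. if \<omega> \<in> S then inv_into S F (s (F \<omega>)) else \<omega>)"


section \<open>Handles and composition\<close>

definition is_handle ::
    "nat \<Rightarrow> nat \<Rightarrow> nat \<Rightarrow> 'a set \<Rightarrow> ((triangle_gen \<times> bool) list set \<Rightarrow> 'a \<Rightarrow> 'a) \<Rightarrow> int \<Rightarrow> 'a \<Rightarrow> 'a \<Rightarrow> bool" where
  "is_handle p q r S \<rho> k a b \<longleftrightarrow>
     a \<in> S \<and> b \<in> S \<and> a \<noteq> b \<and>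
     \<rho> (triangle_x p q r) a = a \<and> \<rho> (triangle_x p q r) b = b \<and>
     ((\<rho> (triangle_x p q r) \<otimes>\<^bsub>sym_grp S\<^esub> \<rho> (triangle_y p q r)) [^]\<^bsub>sym_grp S\<^esub> k) a = b"

definition list_prod :: "('g, 'm) monoid_scheme \<Rightarrow> 'g list \<Rightarrow> 'g" where
  "list_prod G gs = foldr (\<lambda>g h. g \<otimes>\<^bsub>G\<^esub> h) gs \<one>\<^bsub>G\<^esub>"


section \<open>Elementary abelian groups, permutation modules, wreath products\<close>

definition elementary_abelian :: "nat \<Rightarrow> ('g, 'm) monoid_scheme \<Rightarrow> bool" where
  "elementary_abelian p E \<longleftrightarrow> comm_group E \<and> (\<forall>z\<in>carrier E. z [^]\<^bsub>E\<^esub> p = \<one>\<^bsub>E\<^esub>)"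

text \<open>A record of type \<^typ>\<open>('a, 'b) module\<close> extends a ring; its fields \<open>mult\<close> and \<open>one\<close> play no
  role for a module and are left \<^const>\<open>undefined\<close>.\<close>

text \<open>An abelian group, written multiplicatively, whose elements have order dividing \<open>p\<close>,
  considered as a vector space over \<open>residue_ring p\<close>.\<close>

definition power_module :: "('g, 'm) monoid_scheme \<Rightarrow> (int, 'g) module" where
  "power_module E =
     \<lparr>carrier = carrier E, monoid.mult = undefined, one = undefined,
      ring.zero = \<one>\<^bsub>E\<^esub>, ring.add = monoid.mult E, smult = (\<lambda>c z. z [^]\<^bsub>E\<^esub> c)\<rparr>"

text \<open>The vector space with basis \<open>S\<close>: a vector is given by its coordinate function.\<close>

definition perm_module :: "('r, 'm) ring_scheme \<Rightarrow> 'a set \<Rightarrow> ('r, 'a \<Rightarrow> 'r) module" where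
  "perm_module R S =
     \<lparr>carrier = S \<rightarrow>\<^sub>E carrier R, monoid.mult = undefined, one = undefined,
      ring.zero = (\<lambda>\<omega>\<in>S. \<zero>\<^bsub>R\<^esub>),
      ring.add = (\<lambda>v w. \<lambda>\<omega>\<in>S. v \<omega> \<oplus>\<^bsub>R\<^esub> w \<omega>),
      smult = (\<lambda>c v. \<lambda>\<omega>\<in>S. c \<otimes>\<^bsub>R\<^esub> v \<omega>)\<rparr>"

text \<open>The linear map that sends the basis vector \<open>\<omega>\<close> to the basis vector \<open>s \<omega>\<close>.\<close>

definition perm_module_act :: "'a set \<Rightarrow> ('a \<Rightarrow> 'a) \<Rightarrow> ('a \<Rightarrow> 'r) \<Rightarrow> 'a \<Rightarrow> 'r" where
  "perm_module_act S s v = (\<lambda>\<omega>\<in>S. v (inv_into S s \<omega>))"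

definition module_iso ::
    "('r, 'k) ring_scheme \<Rightarrow> ('r, 'a, 'm) module_scheme \<Rightarrow> ('r, 'b, 'n) module_scheme \<Rightarrow> ('a \<Rightarrow> 'b) \<Rightarrow> bool" where
  "module_iso R M M' \<theta> \<longleftrightarrow>
     bij_betw \<theta> (carrier M) (carrier M') \<and>
     (\<forall>v\<in>carrier M. \<forall>w\<in>carrier M. \<theta> (v \<oplus>\<^bsub>M\<^esub> w) = \<theta> v \<oplus>\<^bsub>M'\<^esub> \<theta> w) \<and>
     (\<forall>c\<in>carrier R. \<forall>v\<in>carrier M. \<theta> (c \<odot>\<^bsub>M\<^esub> v) = c \<odot>\<^bsub>M'\<^esub> \<theta> v)"

text \<open>The pair \<open>(c, g)\<close> stands for the product \<open>c g\<close> in the semidirect product of \<open>C\<^sup>S\<close> by \<open>P\<close>,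
  where conjugation by \<open>g\<close> takes the factor with index \<open>\<omega>\<close> to the factor with index \<open>g \<omega>\<close>; hence
  in \<open>c g d h = c (g d g\<^sup>-\<^sup>1) g h\<close> the middle term has \<open>\<omega>\<close>-coordinate \<open>d (g \<omega>)\<close>.\<close>

definition wreath_product ::
    "('c, 'm) monoid_scheme \<Rightarrow> 'a set \<Rightarrow> ('a \<Rightarrow> 'a) set \<Rightarrow> (('a \<Rightarrow> 'c) \<times> ('a \<Rightarrow> 'a)) monoid" where
  "wreath_product C S P =
     \<lparr>carrier = (S \<rightarrow>\<^sub>E carrier C) \<times> P,
      monoid.mult = (\<lambda>(c, g) (d, h). (\<lambda>\<omega>\<in>S. c \<omega> \<otimes>\<^bsub>C\<^esub> d (g \<omega>), g \<otimes>\<^bsub>sym_grp S\<^esub> h)),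
      one = (\<lambda>\<omega>\<in>S. \<one>\<^bsub>C\<^esub>, id)\<rparr>"

end

theory Submission
  imports Defs
begin

text \<open>
  Identify \<open>\<U>\<close> with \<open>\<Omega> \<times> \<int>/p\<close>, where \<open>(\<omega>, i)\<close> is the copy of \<open>\<omega>\<close> in the \<open>i\<close>-th set, so that the blocks
  \<open>B\<^sub>\<omega>\<close> are the fibres of the projection to \<open>\<Omega>\<close>. The permutation \<open>\<phi>(y)\<close> acts as \<open>\<pi>(y)\<close> on the first
  coordinate and leaves the second one alone, and \<open>\<phi>(x)\<close> acts as \<open>\<pi>(x)\<close> on the first coordinate and
  then rotates the fibre over \<open>a\<close> by \<open>1\<close> and the fibre over \<open>b\<close> by \<open>-1\<close>. Both have the form
  \<open>(\<omega>, i) \<mapsto> (s \<omega>, i + c \<omega>)\<close>. Permutations of this form are closed under products and inverses, hence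
  every \<open>\<phi>(g)\<close> has this form, with \<open>s = \<pi>(g)\<close>; this is proved by checking the generators
  (\<open>presented_group_eq_of_generators\<close>). It follows that \<open>H\<close> permutes the fibres as \<open>\<pi>(G)\<close> permutes \<open>\<Omega>\<close>.

  The pairs \<open>(c, s)\<close> multiply as in the wreath product (\<open>lies_over_comp\<close>), which gives the embedding
  of \<open>H\<close>. An element of the kernel \<open>N\<close> has \<open>s = id\<close>, so it is determined by its vector \<open>c\<close>, and products in
  \<open>N\<close> are sums of vectors. Thus \<open>N\<close> is elementary abelian of order at most \<open>p\<^sup>n\<close>, and \<open>c\<close> identifies it
  with a subspace of the permutation module. Conjugation by \<open>h\<close> permutes the entries of \<open>c\<close> according
  to the base permutation of \<open>h\<close> (\<open>conj_kern\<close>), so it factors through the action on the blocks and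
  agrees with the action on the permutation module.

  Finally \<open>x\<close> fixes \<open>a\<close>, so \<open>\<phi>(x)\<close> rotates the fibre over \<open>a\<close> by one step. Together with transitivity
  of \<open>\<pi>\<close> this makes \<open>H\<close> transitive (\<open>transitiveI\<close>). The setwise stabiliser of a fibre acts on it by
  rotations only, and by transitivity as the group of all rotations (\<open>induced_perms_eq_rotations\<close>),
  which is cyclic of order \<open>p\<close>.
\<close>

section \<open>Permutation groups\<close>

lemma sym_grp_simps [simp]:
  "carrier (sym_grp S) = {g. g permutes S}"
  "g \<otimes>\<^bsub>sym_grp S\<^esub> h = h \<circ> g"
  "\<one>\<^bsub>sym_grp S\<^esub> = id"
  by (simp_all add: sym_grp_def)

lemma perm_grp_simps [simp]:
  "carrier (perm_grp S H) = H"
  "g \<otimes>\<^bsub>perm_grp S H\<^esub> h = h \<circ> g"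
  "\<one>\<^bsub>perm_grp S H\<^esub> = id"
  by (simp_all add: perm_grp_def sym_grp_def)

lemma inv_sym_grp:
  assumes "g permutes S"
  shows "inv\<^bsub>sym_grp S\<^esub> g = inv_into UNIV g"
  by (rule group.inv_equality[OF group_sym_grp])
     (use assms in \<open>auto simp: permutes_inv permutes_inv_o\<close>)

lemma group_perm_grp:
  assumes "subgroup H (sym_grp S)"
  shows "group (perm_grp S H)"
  unfolding perm_grp_def by (rule subgroup.subgroup_is_group[OF assms group_sym_grp])

lemma inv_perm_grp:
  assumes "subgroup H (sym_grp S)" "h \<in> H"
  shows "inv\<^bsub>perm_grp S H\<^esub> h = inv_into UNIV h"
proof -
  have "h permutes S"
    using subgroup.subset[OF assms(1)] assms(2) by auto
  then show ?thesis
    unfolding perm_grp_def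
    using group.m_inv_consistent[OF group_sym_grp assms] inv_sym_grp by metis
qed

lemma subgroup_sym_grpD:
  assumes "subgroup H (sym_grp S)"
  shows "h \<in> H \<Longrightarrow> h permutes S" "id \<in> H" "g \<in> H \<Longrightarrow> h \<in> H \<Longrightarrow> h \<circ> g \<in> H"
    "h \<in> H \<Longrightarrow> inv_into UNIV h \<in> H"
proof -
  show perm: "h permutes S" if "h \<in> H" for h
    using subgroup.subset[OF assms] that by auto
  show "id \<in> H"
    using subgroup.one_closed[OF assms] by simp
  show "h \<circ> g \<in> H" if "g \<in> H" "h \<in> H" for g h
    using subgroup.m_closed[OF assms that] by simp
  show "inv_into UNIV h \<in> H" if "h \<in> H" for h
    using subgroup.m_inv_closed[OF assms that] inv_sym_grp[OF perm[OF that]] by simp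
qed

text \<open>Bijectivity need not be checked point by point: each \<open>f g\<close> is inverted by the image of the
  inverse of \<open>g\<close>.\<close>

lemma hom_sym_grpI:
  assumes "group G"
    and one: "f \<one>\<^bsub>G\<^esub> = id"
    and mult: "\<And>g h. g \<in> carrier G \<Longrightarrow> h \<in> carrier G \<Longrightarrow> f (g \<otimes>\<^bsub>G\<^esub> h) = f h \<circ> f g"
    and outside: "\<And>g x. g \<in> carrier G \<Longrightarrow> x \<notin> S \<Longrightarrow> f g x = x"
  shows "f \<in> hom G (sym_grp S)"
proof -
  interpret group G by fact
  have "f g permutes S" if g: "g \<in> carrier G" for g
  proof -
    have "f (inv\<^bsub>G\<^esub> g) \<circ> f g = id" "f g \<circ> f (inv\<^bsub>G\<^esub> g) = id"
      using g one mult[of g "inv\<^bsub>G\<^esub> g"] mult[of "inv\<^bsub>G\<^esub> g" g] by simp_all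
    then have "bij (f g)"
      by (rule o_bij)
    then show ?thesis
      using outside[OF g] by (simp add: permutes_def bij_iff)
  qed
  then show ?thesis
    by (simp add: hom_def mult)
qed

section \<open>Generators of a presented group\<close>

text \<open>A word is a product of letters, and a letter \<open>(g, False)\<close> is the inverse of the generator \<open>g\<close>.\<close>

lemma presented_group_eq_of_generators:
  assumes K: "subgroup K (presented_group R)"
    and gens: "\<And>g. pres_class R [(g, True)] \<in> K"
  shows "K = carrier (presented_group R)"
proof
  show "K \<subseteq> carrier (presented_group R)"
    using K by (rule subgroup.subset)
  have one: "\<one>\<^bsub>presented_group R\<^esub> = pres_class R []"
    by (simp add: presented_group_def)
  have letter: "pres_class R [(g, e)] \<in> K" for g e
  proof (cases e)
    case True
    then show ?thesis using gens by simp
  next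
    case False
    have "pres_class R [(g, False)] \<otimes>\<^bsub>presented_group R\<^esub> pres_class R [(g, True)]
        = \<one>\<^bsub>presented_group R\<^esub>"
      using pres_eq.cancel[of R g False] by (simp add: one pres_class_mult pres_class_eq_iff)
    then have "inv\<^bsub>presented_group R\<^esub> (pres_class R [(g, True)]) = pres_class R [(g, False)]"
      by (intro group.inv_equality[OF group_presented_group]) (auto simp: presented_group_def)
    then show ?thesis
      using subgroup.m_inv_closed[OF K gens[of g]] False by simp
  qed
  have "pres_class R w \<in> K" for w
  proof (induction w)
    case Nil
    then show ?case using subgroup.one_closed[OF K] by (simp add: one)
  next
    case (Cons l w)
    obtain g e where "l = (g, e)" by (cases l)
    then have "pres_class R (l # w)
        = pres_class R [(g, e)] \<otimes>\<^bsub>presented_group R\<^esub> pres_class R w"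
      by (simp add: pres_class_mult)
    then show ?case
      using subgroup.m_closed[OF K letter Cons.IH] by simp
  qed
  then show "carrier (presented_group R) \<subseteq> K"
    by (auto simp: presented_group_def)
qed

section \<open>Cycles and products of disjoint permutations\<close>

lemma cycle_of_list_nth:
  assumes "distinct cs" "k < length cs"
  shows "cycle_of_list cs (cs ! k) = cs ! (Suc k mod length cs)"
proof -
  have "map (cycle_of_list cs) cs = rotate 1 cs"
    using cyclic_rotation[OF assms(1), of 1] by simp
  then have "map (cycle_of_list cs) cs ! k = rotate 1 cs ! k"
    by simp
  then show ?thesis
    using assms(2) by (simp add: nth_rotate del: rotate_Suc)
qed

lemma list_prod_outside:
  assumes "\<And>i. i \<in> set is \<Longrightarrow> g i permutes A i \<and> u \<notin> A i"
  shows "list_prod (sym_grp S) (map g is) u = u"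
  using assms
proof (induction "is")
  case (Cons i "is")
  then have "g i u = u" by (auto intro: permutes_not_in)
  with Cons show ?case by (simp add: list_prod_def)
qed (simp add: list_prod_def)

text \<open>A point moved by at most one of the factors is left alone by all factors before and after
  that one, so only this factor shows in the product.\<close>

lemma list_prod_disjoint:
  assumes "distinct is" "disjoint_family_on A (set is)"
    and "\<And>i. i \<in> set is \<Longrightarrow> g i permutes A i"
    and "j \<in> set is" "u \<in> A j"
  shows "list_prod (sym_grp S) (map g is) u = g j u"
  using assms
proof (induction "is")
  case (Cons i "is")
  have step: "list_prod (sym_grp S) (map g (i # is)) u = list_prod (sym_grp S) (map g is) (g i u)"
    by (simp add: list_prod_def)
  show ?case
  proof (cases "j = i")
    case True
    then have "g i u \<in> A i"
      using Cons.prems permutes_in_image[of "g i" "A i" u] by simp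
    then have "g i' permutes A i' \<and> g i u \<notin> A i'" if "i' \<in> set is" for i'
      using Cons.prems(1,2,3) that unfolding disjoint_family_on_def by fastforce
    then show ?thesis
      unfolding step using list_prod_outside True by metis
  next
    case False
    then have "u \<notin> A i"
      using Cons.prems unfolding disjoint_family_on_def by fastforce
    then have "g i u = u"
      using Cons.prems(3)[of i] by (auto intro: permutes_not_in)
    moreover have "disjoint_family_on A (set is)"
      using Cons.prems(2) by (rule disjoint_family_on_mono[rotated]) auto
    ultimately show ?thesis
      unfolding step using Cons False by simp
  qed
qed simp

section \<open>Wreath products and permutation modules\<close>

lemma wreath_product_simps:
  "carrier (wreath_product C S P) = (S \<rightarrow>\<^sub>E carrier C) \<times> P"
  "(c, g) \<otimes>\<^bsub>wreath_product C S P\<^esub> (d, h) = (\<lambda>\<omega>\<in>S. c \<omega> \<otimes>\<^bsub>C\<^esub> d (g \<omega>), h \<circ> g)"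
  "\<one>\<^bsub>wreath_product C S P\<^esub> = (\<lambda>\<omega>\<in>S. \<one>\<^bsub>C\<^esub>, id)"
  by (simp_all add: wreath_product_def)

text \<open>Inverse of \<open>(c, g)\<close>: the vector must be moved back along \<open>g\<close> before it is inverted.\<close>

lemma group_wreath_product:
  assumes "group C" and P: "subgroup P (sym_grp S)"
  shows "group (wreath_product C S P)"
proof -
  interpret C: group C by fact
  note P = subgroup_sym_grpD[OF P]
  have app: "c \<omega> \<in> carrier C" if "c \<in> S \<rightarrow>\<^sub>E carrier C" "\<omega> \<in> S" for c \<omega>
    using that by auto
  have S: "g \<omega> \<in> S \<longleftrightarrow> \<omega> \<in> S" if "g \<in> P" for g \<omega>
    using permutes_in_image[OF P(1)[OF that]] .
  show ?thesis
  proof (rule groupI)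
    fix u v w
    assume "u \<in> carrier (wreath_product C S P)" "v \<in> carrier (wreath_product C S P)"
      "w \<in> carrier (wreath_product C S P)"
    then obtain c g d h k f where *: "u = (c, g)" "v = (d, h)" "w = (k, f)"
      "c \<in> S \<rightarrow>\<^sub>E carrier C" "d \<in> S \<rightarrow>\<^sub>E carrier C" "k \<in> S \<rightarrow>\<^sub>E carrier C" "g \<in> P" "h \<in> P" "f \<in> P"
      by (auto simp: wreath_product_simps)
    then show "u \<otimes>\<^bsub>wreath_product C S P\<^esub> v \<otimes>\<^bsub>wreath_product C S P\<^esub> w =
        u \<otimes>\<^bsub>wreath_product C S P\<^esub> (v \<otimes>\<^bsub>wreath_product C S P\<^esub> w)"
      by (auto simp: wreath_product_simps fun_eq_iff S app C.m_assoc)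
  next
    fix u v
    assume "u \<in> carrier (wreath_product C S P)" "v \<in> carrier (wreath_product C S P)"
    then show "u \<otimes>\<^bsub>wreath_product C S P\<^esub> v \<in> carrier (wreath_product C S P)"
      by (auto simp: wreath_product_simps P S app intro!: C.m_closed)
  next
    show "\<one>\<^bsub>wreath_product C S P\<^esub> \<in> carrier (wreath_product C S P)"
      by (auto simp: wreath_product_simps P)
  next
    fix u
    assume "u \<in> carrier (wreath_product C S P)"
    then show "\<one>\<^bsub>wreath_product C S P\<^esub> \<otimes>\<^bsub>wreath_product C S P\<^esub> u = u"
      by (cases u) (simp add: wreath_product_simps fun_eq_iff PiE_iff extensional_def)
  next
    fix u
    assume "u \<in> carrier (wreath_product C S P)"
    then obtain c g where u: "u = (c, g)" "c \<in> S \<rightarrow>\<^sub>E carrier C" "g \<in> P"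
      by (auto simp: wreath_product_simps)
    let ?g = "inv_into UNIV g"
    have g: "?g \<in> P" "g \<circ> ?g = id"
      using P(4)[OF u(3)] permutes_inv_o(1)[OF P(1)[OF u(3)]] by simp_all
    then show "\<exists>v\<in>carrier (wreath_product C S P).
        v \<otimes>\<^bsub>wreath_product C S P\<^esub> u = \<one>\<^bsub>wreath_product C S P\<^esub>"
      using u(2) g(1) unfolding u(1)
      by (intro bexI[of _ "(\<lambda>\<omega>\<in>S. inv\<^bsub>C\<^esub> c (?g \<omega>), ?g)"])
         (simp_all add: wreath_product_simps g(2) app S C.l_inv cong: restrict_cong)
  qed
qed

lemma perm_module_simps:
  "carrier (perm_module R S) = S \<rightarrow>\<^sub>E carrier R"
  "v \<oplus>\<^bsub>perm_module R S\<^esub> w = (\<lambda>\<omega>\<in>S. v \<omega> \<oplus>\<^bsub>R\<^esub> w \<omega>)"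
  "\<zero>\<^bsub>perm_module R S\<^esub> = (\<lambda>\<omega>\<in>S. \<zero>\<^bsub>R\<^esub>)"
  "t \<odot>\<^bsub>perm_module R S\<^esub> v = (\<lambda>\<omega>\<in>S. t \<otimes>\<^bsub>R\<^esub> v \<omega>)"
  by (simp_all add: perm_module_def)

lemma group_perm_module:
  assumes "abelian_group R"
  shows "group (add_monoid (perm_module R S))"
proof -
  interpret R: abelian_group R by fact
  show ?thesis
  proof (rule groupI)
    fix v
    assume v: "v \<in> carrier (add_monoid (perm_module R S))"
    then have "(\<lambda>\<omega>\<in>S. \<ominus>\<^bsub>R\<^esub> v \<omega>) \<in> carrier (add_monoid (perm_module R S))"
      by (simp add: perm_module_simps PiE_iff)
    moreover have "(\<lambda>\<omega>\<in>S. \<ominus>\<^bsub>R\<^esub> v \<omega>) \<otimes>\<^bsub>add_monoid (perm_module R S)\<^esub> v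
        = \<one>\<^bsub>add_monoid (perm_module R S)\<^esub>"
      using v by (simp add: perm_module_simps fun_eq_iff PiE_iff R.l_neg)
    ultimately show "\<exists>w\<in>carrier (add_monoid (perm_module R S)).
        w \<otimes>\<^bsub>add_monoid (perm_module R S)\<^esub> v = \<one>\<^bsub>add_monoid (perm_module R S)\<^esub>"
      by blast
  qed (simp_all add: perm_module_simps fun_eq_iff PiE_iff R.a_assoc extensional_def)
qed

section \<open>Cyclic covers\<close>

text \<open>Pairwise disjoint, cyclically ordered sets of \<open>m\<close> points, one over each point of \<open>\<Omega>\<close>. The points over
  \<open>\<omega>\<close> are numbered by residues modulo \<open>m\<close>; letting the number range over all integers keeps shifts
  free of case distinctions at the ends of the range.\<close>

locale cyclic_cover =
  fixes m :: nat and \<Omega> :: "'a set" and e :: "'a \<Rightarrow> int \<Rightarrow> 'b"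
  assumes m_gt_1: "1 < m"
    and finite_base: "finite \<Omega>"
    and point_eq_iff:
      "\<omega> \<in> \<Omega> \<Longrightarrow> \<omega>' \<in> \<Omega> \<Longrightarrow> e \<omega> i = e \<omega>' j \<longleftrightarrow> \<omega> = \<omega>' \<and> i mod int m = j mod int m"
begin

definition fibre :: "'a \<Rightarrow> 'b set" where
  "fibre \<omega> = range (e \<omega>)"

definition total :: "'b set" where
  "total = (\<Union>\<omega>\<in>\<Omega>. fibre \<omega>)"

text \<open>\<open>h\<close> carries the fibre over \<open>\<omega>\<close> to the fibre over \<open>s \<omega>\<close>, advancing the number by \<open>c \<omega>\<close>. The
  entries of \<open>c\<close> are reduced modulo \<open>m\<close> so that \<open>h\<close> determines \<open>c\<close>; these pairs \<open>(c, s)\<close> are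
  the elements of a wreath product, and \<open>lies_over_comp\<close> is its multiplication.\<close>

definition lies_over :: "('b \<Rightarrow> 'b) \<Rightarrow> ('a \<Rightarrow> int) \<Rightarrow> ('a \<Rightarrow> 'a) \<Rightarrow> bool" where
  "lies_over h c s \<longleftrightarrow> h permutes total \<and> s permutes \<Omega> \<and> c \<in> \<Omega> \<rightarrow>\<^sub>E {0..<int m} \<and>
     (\<forall>\<omega>\<in>\<Omega>. \<forall>i. h (e \<omega> i) = e (s \<omega>) (i + c \<omega>))"

lemma point_in_total: "\<omega> \<in> \<Omega> \<Longrightarrow> e \<omega> i \<in> total"
  by (auto simp: total_def fibre_def)

lemma totalE:
  assumes "u \<in> total"
  obtains \<omega> i where "\<omega> \<in> \<Omega>" "u = e \<omega> i"
  using assms by (auto simp: total_def fibre_def)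

lemma point_cong: "\<omega> \<in> \<Omega> \<Longrightarrow> i mod int m = j mod int m \<Longrightarrow> e \<omega> i = e \<omega> j"
  using point_eq_iff by blast

lemma fibre_eq_iff: "\<omega> \<in> \<Omega> \<Longrightarrow> \<omega>' \<in> \<Omega> \<Longrightarrow> fibre \<omega> = fibre \<omega>' \<longleftrightarrow> \<omega> = \<omega>'"
  using point_eq_iff by (metis fibre_def rangeE rangeI)

lemma fibre_disjoint: "\<omega> \<in> \<Omega> \<Longrightarrow> \<omega>' \<in> \<Omega> \<Longrightarrow> \<omega> \<noteq> \<omega>' \<Longrightarrow> fibre \<omega> \<inter> fibre \<omega>' = {}"
  using point_eq_iff by (auto simp: fibre_def)

lemma inj_on_fibre: "inj_on fibre \<Omega>"
  using fibre_eq_iff by (auto simp: inj_on_def)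

text \<open>The shifts may be given by arbitrary integers; reduction modulo \<open>m\<close> is supplied here.\<close>

lemma lies_overI:
  assumes "h permutes total" "s permutes \<Omega>"
    and h: "\<And>\<omega> i. \<omega> \<in> \<Omega> \<Longrightarrow> h (e \<omega> i) = e (s \<omega>) (i + c \<omega>)"
  shows "lies_over h (\<lambda>\<omega>\<in>\<Omega>. c \<omega> mod int m) s"
  unfolding lies_over_def
proof (intro conjI ballI allI)
  show "(\<lambda>\<omega>\<in>\<Omega>. c \<omega> mod int m) \<in> \<Omega> \<rightarrow>\<^sub>E {0..<int m}"
    using m_gt_1 by auto
  show "h (e \<omega> i) = e (s \<omega>) (i + (\<lambda>\<omega>\<in>\<Omega>. c \<omega> mod int m) \<omega>)" if "\<omega> \<in> \<Omega>" for \<omega> i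
    using that permutes_in_image[OF assms(2)] by (simp add: h) (intro point_cong, auto simp: mod_simps)
qed fact+

lemma lies_overD:
  assumes "lies_over h c s"
  shows "h permutes total" "s permutes \<Omega>" "c \<in> \<Omega> \<rightarrow>\<^sub>E {0..<int m}"
    "\<omega> \<in> \<Omega> \<Longrightarrow> h (e \<omega> i) = e (s \<omega>) (i + c \<omega>)" "s \<omega> \<in> \<Omega> \<longleftrightarrow> \<omega> \<in> \<Omega>"
    "\<omega> \<in> \<Omega> \<Longrightarrow> c \<omega> mod int m = c \<omega>"
proof -
  show "h permutes total" "s permutes \<Omega>" and c: "c \<in> \<Omega> \<rightarrow>\<^sub>E {0..<int m}"
    and "\<omega> \<in> \<Omega> \<Longrightarrow> h (e \<omega> i) = e (s \<omega>) (i + c \<omega>)"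
    using assms by (auto simp: lies_over_def)
  then show "s \<omega> \<in> \<Omega> \<longleftrightarrow> \<omega> \<in> \<Omega>"
    using permutes_in_image by metis
  show "c \<omega> mod int m = c \<omega>" if "\<omega> \<in> \<Omega>"
    using PiE_mem[OF c that] by simp
qed

text \<open>The image of the point numbered 0 in a fibre reveals both the target fibre and the shift.\<close>

lemma lies_over_unique:
  assumes 1: "lies_over h c s" and 2: "lies_over h c' s'"
  shows "c = c'" "s = s'"
proof -
  have *: "s \<omega> = s' \<omega> \<and> c \<omega> = c' \<omega>" if "\<omega> \<in> \<Omega>" for \<omega>
  proof -
    have "e (s \<omega>) (0 + c \<omega>) = e (s' \<omega>) (0 + c' \<omega>)"
      using lies_overD(4)[OF 1 that] lies_overD(4)[OF 2 that] by metis
    then have "s \<omega> = s' \<omega> \<and> c \<omega> mod int m = c' \<omega> mod int m"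
      using that lies_overD(5)[OF 1] lies_overD(5)[OF 2] by (simp add: point_eq_iff)
    then show ?thesis
      using lies_overD(6)[OF 1 that] lies_overD(6)[OF 2 that] by simp
  qed
  show "c = c'"
    using lies_overD(3)[OF 1] lies_overD(3)[OF 2] * by (intro PiE_ext) auto
  show "s = s'"
    using lies_overD(2)[OF 1] lies_overD(2)[OF 2] * by (metis ext permutes_not_in)
qed

lemma lies_over_inject:
  assumes 1: "lies_over h c s" and 2: "lies_over h' c s"
  shows "h = h'"
proof
  fix u
  show "h u = h' u"
  proof (cases "u \<in> total")
    case True
    then show ?thesis
      by (rule totalE) (simp add: lies_overD(4)[OF 1] lies_overD(4)[OF 2])
  next
    case False
    then show ?thesis
      using permutes_not_in[OF lies_overD(1)[OF 1]] permutes_not_in[OF lies_overD(1)[OF 2]] by simp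
  qed
qed

lemma lies_over_id: "lies_over id (\<lambda>\<omega>\<in>\<Omega>. 0) id"
  using lies_overI[of id id "\<lambda>_. 0"] by (simp add: permutes_id)

lemma lies_over_comp:
  assumes 1: "lies_over h c s" and 2: "lies_over h' c' s'"
  shows "lies_over (h' \<circ> h) (\<lambda>\<omega>\<in>\<Omega>. (c \<omega> + c' (s \<omega>)) mod int m) (s' \<circ> s)"
proof (rule lies_overI)
  show "h' \<circ> h permutes total" "s' \<circ> s permutes \<Omega>"
    using lies_overD(1,2)[OF 1] lies_overD(1,2)[OF 2] by (auto intro: permutes_compose)
  show "(h' \<circ> h) (e \<omega> i) = e ((s' \<circ> s) \<omega>) (i + (c \<omega> + c' (s \<omega>)))" if "\<omega> \<in> \<Omega>" for \<omega> i
    using that by (simp add: lies_overD(4,5)[OF 1] lies_overD(4)[OF 2] add.assoc)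
qed

lemma lies_over_inv:
  assumes 1: "lies_over h c s"
  shows "lies_over (inv_into UNIV h) (\<lambda>\<omega>\<in>\<Omega>. (- c (inv_into UNIV s \<omega>)) mod int m) (inv_into UNIV s)"
proof (rule lies_overI)
  note h = lies_overD(1)[OF 1] and s = lies_overD(2)[OF 1]
  show "inv_into UNIV h permutes total" "inv_into UNIV s permutes \<Omega>"
    using h s by (auto intro: permutes_inv)
  show "inv_into UNIV h (e \<omega> i) = e (inv_into UNIV s \<omega>) (i + - c (inv_into UNIV s \<omega>))"
    if "\<omega> \<in> \<Omega>" for \<omega> i
  proof -
    have "inv_into UNIV s \<omega> \<in> \<Omega>"
      using that permutes_in_image[OF permutes_inv[OF s]] by simp
    then have "h (e (inv_into UNIV s \<omega>) (i + - c (inv_into UNIV s \<omega>))) = e \<omega> i"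
      by (simp add: lies_overD(4)[OF 1] permutes_inverses(1)[OF s])
    then show ?thesis
      using permutes_inverses(2)[OF h] by metis
  qed
qed

lemma lies_over_image_fibre:
  assumes "lies_over h c s" "\<omega> \<in> \<Omega>"
  shows "h ` fibre \<omega> = fibre (s \<omega>)"
proof -
  have "h ` fibre \<omega> = range (\<lambda>i. e (s \<omega>) (i + c \<omega>))"
    using lies_overD(4)[OF assms] by (simp add: fibre_def image_image)
  also have "\<dots> = e (s \<omega>) ` range (\<lambda>i. i + c \<omega>)"
    by (simp only: image_image)
  also have "range (\<lambda>i. i + c \<omega>) = UNIV"
    by (rule surjI[of _ "\<lambda>i. i - c \<omega>"]) simp
  finally show ?thesis by (simp only: fibre_def)
qed

text \<open>The coordinates \<open>c\<close> and \<open>s\<close> of a permutation that respects the fibres. The permutation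
  \<open>s\<close> is read off from the action on the set of fibres, which makes it depend on that action only.\<close>

definition shift :: "('b \<Rightarrow> 'b) \<Rightarrow> 'a \<Rightarrow> int" where
  "shift h = (THE c. \<exists>s. lies_over h c s)"

definition base_perm :: "('b \<Rightarrow> 'b) \<Rightarrow> 'a \<Rightarrow> 'a" where
  "base_perm h = pullback_perm \<Omega> fibre (block_action (fibre ` \<Omega>) h)"

lemma shift_eq: "lies_over h c s \<Longrightarrow> shift h = c"
  unfolding shift_def using lies_over_unique by blast

lemma base_perm_eq:
  assumes "lies_over h c s"
  shows "base_perm h = s"
proof
  fix \<omega>
  show "base_perm h \<omega> = s \<omega>"
  proof (cases "\<omega> \<in> \<Omega>")
    case True
    then show ?thesis
      using lies_over_image_fibre[OF assms True] lies_overD(5)[OF assms] inj_on_fibre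
      by (simp add: base_perm_def pullback_perm_def block_action_def)
  next
    case False
    then show ?thesis
      using permutes_not_in[OF lies_overD(2)[OF assms]] by (simp add: base_perm_def pullback_perm_def)
  qed
qed

text \<open>The number of a point is determined only modulo \<open>m\<close>; \<open>inv_into\<close> selects one of its integer
  representatives, and the choice does not affect the result.\<close>

definition rotation :: "'a \<Rightarrow> int \<Rightarrow> 'b \<Rightarrow> 'b" where
  "rotation \<omega> j = (\<lambda>u. if u \<in> fibre \<omega> then e \<omega> (inv_into UNIV (e \<omega>) u + j) else u)"

lemma rotation_point:
  assumes "\<omega> \<in> \<Omega>" "\<omega>' \<in> \<Omega>"
  shows "rotation \<omega> j (e \<omega>' i) = e \<omega>' (i + (if \<omega>' = \<omega> then j else 0))"
proof (cases "\<omega>' = \<omega>")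
  case True
  have "e \<omega> (inv_into UNIV (e \<omega>) (e \<omega> i)) = e \<omega> i"
    by (rule f_inv_into_f) simp
  then have "inv_into UNIV (e \<omega>) (e \<omega> i) mod int m = i mod int m"
    using assms point_eq_iff by blast
  then show ?thesis
    using True assms by (auto simp: rotation_def fibre_def intro!: point_cong mod_add_cong)
next
  case False
  then show ?thesis
    using assms point_eq_iff by (auto simp: rotation_def fibre_def)
qed

lemma rotation_outside: "u \<notin> fibre \<omega> \<Longrightarrow> rotation \<omega> j u = u"
  by (simp add: rotation_def)

lemma rotation_comp:
  assumes "\<omega> \<in> \<Omega>"
  shows "rotation \<omega> j \<circ> rotation \<omega> i = rotation \<omega> (i + j)"
proof
  fix u
  show "(rotation \<omega> j \<circ> rotation \<omega> i) u = rotation \<omega> (i + j) u"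
    using assms by (cases "u \<in> fibre \<omega>") (auto simp: fibre_def rotation_point rotation_outside add.assoc)
qed

lemma rotation_eq_iff:
  assumes "\<omega> \<in> \<Omega>"
  shows "rotation \<omega> i = rotation \<omega> j \<longleftrightarrow> i mod int m = j mod int m"
proof
  assume "rotation \<omega> i = rotation \<omega> j"
  then have "rotation \<omega> i (e \<omega> 0) = rotation \<omega> j (e \<omega> 0)" by simp
  then show "i mod int m = j mod int m"
    using assms by (simp add: rotation_point point_eq_iff)
next
  assume "i mod int m = j mod int m"
  then show "rotation \<omega> i = rotation \<omega> j"
    using assms by (auto simp: rotation_def intro!: point_cong mod_add_cong)
qed

lemma rotation_0: "\<omega> \<in> \<Omega> \<Longrightarrow> rotation \<omega> 0 = id"
  by (rule ext) (auto simp: rotation_def fibre_def f_inv_into_f)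

lemma rotation_permutes:
  assumes "\<omega> \<in> \<Omega>"
  shows "rotation \<omega> j permutes total"
proof -
  have "rotation \<omega> (- j) \<circ> rotation \<omega> j = id" "rotation \<omega> j \<circ> rotation \<omega> (- j) = id"
    using assms by (simp_all add: rotation_comp rotation_0)
  then have "bij (rotation \<omega> j)"
    by (rule o_bij)
  moreover have "rotation \<omega> j u = u" if "u \<notin> total" for u
    using that assms by (intro rotation_outside) (auto simp: total_def)
  ultimately show ?thesis
    by (simp add: permutes_def bij_iff)
qed

lemma rotation_mon:
  assumes "\<omega> \<in> \<Omega>"
  shows "rotation \<omega> \<in> mon (integer_mod_group m) (sym_grp total)"
  using assms m_gt_1
  by (auto simp: mon_def hom_def inj_on_def carrier_integer_mod_group rotation_permutes
      rotation_comp rotation_eq_iff)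

text \<open>Listing a fibre upwards (\<open>t = 1\<close>) or downwards (\<open>t = -1\<close>), from any starting point \<open>d\<close>, gives
  the rotation by \<open>t\<close>: since \<open>t\<close> is its own inverse, \<open>k \<mapsto> d + t k\<close> runs through every residue once.\<close>

lemma cycle_eq_rotation:
  assumes \<omega>: "\<omega> \<in> \<Omega>" and t: "t * t = 1"
  shows "cycle_of_list (map (\<lambda>k. e \<omega> (d + t * int k)) [0..<m]) = rotation \<omega> t"
proof
  let ?cs = "map (\<lambda>k. e \<omega> (d + t * int k)) [0..<m]"
  have index: "\<exists>k<m. (d + t * int k) mod int m = i mod int m" for i
  proof (intro exI conjI)
    let ?k = "nat ((t * (i - d)) mod int m)"
    show "?k < m" using m_gt_1 by (simp add: nat_less_iff)
    have "(d + t * int ?k) mod int m = (d + t * (t * (i - d))) mod int m"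
      using m_gt_1 by simp (metis mod_add_right_eq mod_mult_right_eq)
    also have "d + t * (t * (i - d)) = i"
      using t by (simp flip: mult.assoc)
    finally show "(d + t * int ?k) mod int m = i mod int m" .
  qed
  have set: "fibre \<omega> = set ?cs"
  proof
    show "fibre \<omega> \<subseteq> set ?cs"
    proof
      fix u assume "u \<in> fibre \<omega>"
      then obtain i where i: "u = e \<omega> i" by (auto simp: fibre_def)
      obtain k where k: "k < m" "(d + t * int k) mod int m = i mod int m" using index by blast
      then have "u = e \<omega> (d + t * int k)"
        unfolding i by (intro point_cong[OF \<omega>]) simp
      then show "u \<in> set ?cs" using k(1) by simp
    qed
  qed (auto simp: fibre_def)
  have "inj_on (\<lambda>k. e \<omega> (d + t * int k)) {0..<m}"
  proof (rule inj_onI)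
    fix k l assume kl: "k \<in> {0..<m}" "l \<in> {0..<m}" "e \<omega> (d + t * int k) = e \<omega> (d + t * int l)"
    then have "[d + t * int k = d + t * int l] (mod int m)"
      using \<omega> by (simp add: point_eq_iff cong_def)
    then have "[t * int k = t * int l] (mod int m)"
      by (simp add: cong_add_lcancel)
    then have "[t * (t * int k) = t * (t * int l)] (mod int m)"
      by (rule cong_scalar_left)
    then show "k = l"
      using kl t by (simp add: cong_def flip: mult.assoc)
  qed
  then have dist: "distinct ?cs"
    by (simp add: distinct_map)
  fix u
  show "cycle_of_list ?cs u = rotation \<omega> t u"
  proof (cases "u \<in> fibre \<omega>")
    case True
    then obtain k where k: "k < m" "u = e \<omega> (d + t * int k)"
      using set by auto
    have "cycle_of_list ?cs u = e \<omega> (d + t * int (Suc k mod m))"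
      using cycle_of_list_nth[OF dist, of k] k m_gt_1 by simp
    also have "\<dots> = e \<omega> (d + t * int k + t)"
    proof (rule point_cong[OF \<omega>])
      have "(d + t * int (Suc k mod m)) mod int m = (d + t * int (Suc k)) mod int m"
        unfolding zmod_int by (metis mod_add_right_eq mod_mult_right_eq)
      then show "(d + t * int (Suc k mod m)) mod int m = (d + t * int k + t) mod int m"
        by (simp add: algebra_simps)
    qed
    also have "\<dots> = rotation \<omega> t u"
      using \<omega> by (simp add: k rotation_point)
    finally show ?thesis .
  next
    case False
    then show ?thesis
      by (metis set id_outside_supp rotation_outside)
  qed
qed

end

section \<open>Groups acting on a cyclic cover\<close>

text \<open>A group of permutations with coordinates amounts to a subgroup of the wreath product of \<open>C\<^sub>m\<close> with its
  base group. All the structure asserted of \<open>H\<close> is read off from these coordinates.\<close>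

locale fibre_preserving_group = cyclic_cover +
  fixes H :: "('b \<Rightarrow> 'b) set"
  assumes subgroup_H: "subgroup H (sym_grp total)"
    and ex_lies_over: "h \<in> H \<Longrightarrow> \<exists>c s. lies_over h c s"
begin

abbreviation blocks :: "'b set set" where
  "blocks \<equiv> fibre ` \<Omega>"

definition kern :: "('b \<Rightarrow> 'b) set" where
  "kern = kernel (perm_grp total H) (sym_grp blocks) (block_action blocks)"

lemmas H_closed = subgroup_sym_grpD[OF subgroup_H]

lemma group_H: "group (perm_grp total H)"
  by (rule group_perm_grp[OF subgroup_H])

lemma lies: "h \<in> H \<Longrightarrow> lies_over h (shift h) (base_perm h)"
  using ex_lies_over shift_eq base_perm_eq by blast

lemma H_determined:
  assumes "h \<in> H" "h' \<in> H" "shift h = shift h'" "base_perm h = base_perm h'"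
  shows "h = h'"
  using lies_over_inject lies[OF assms(1)] lies[OF assms(2)] assms(3,4) by metis

lemma coords_comp:
  assumes "g \<in> H" "h \<in> H"
  shows "base_perm (h \<circ> g) = base_perm h \<circ> base_perm g"
    "shift (h \<circ> g) = (\<lambda>\<omega>\<in>\<Omega>. (shift g \<omega> + shift h (base_perm g \<omega>)) mod int m)"
  using base_perm_eq shift_eq lies_over_comp[OF lies[OF assms(1)] lies[OF assms(2)]] by blast+

lemma coords_id:
  "base_perm id = id" "shift id = (\<lambda>\<omega>\<in>\<Omega>. 0)"
  using base_perm_eq shift_eq lies_over_id by blast+

lemma coords_inv:
  assumes "h \<in> H"
  shows "base_perm (inv_into UNIV h) = inv_into UNIV (base_perm h)"
    "shift (inv_into UNIV h) = (\<lambda>\<omega>\<in>\<Omega>. (- shift h (inv_into UNIV (base_perm h) \<omega>)) mod int m)"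
  using base_perm_eq shift_eq lies_over_inv[OF lies[OF assms]] by blast+

lemma image_fibre: "h \<in> H \<Longrightarrow> \<omega> \<in> \<Omega> \<Longrightarrow> h ` fibre \<omega> = fibre (base_perm h \<omega>)"
  using lies lies_over_image_fibre by blast

lemma base_perm_in: "h \<in> H \<Longrightarrow> base_perm h \<omega> \<in> \<Omega> \<longleftrightarrow> \<omega> \<in> \<Omega>"
  using lies lies_overD(5) by blast

lemma shift_mod: "h \<in> H \<Longrightarrow> \<omega> \<in> \<Omega> \<Longrightarrow> shift h \<omega> mod int m = shift h \<omega>"
  using lies lies_overD(6) by blast

lemma shift_in: "h \<in> H \<Longrightarrow> shift h \<in> \<Omega> \<rightarrow>\<^sub>E {0..<int m}"
  using lies lies_overD(3) by blast

lemma subgroup_base: "subgroup (base_perm ` H) (sym_grp \<Omega>)"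
proof -
  have "base_perm \<in> hom (perm_grp total H) (sym_grp \<Omega>)"
    using lies lies_overD(2) by (auto simp: hom_def coords_comp)
  then have "group_hom (perm_grp total H) (sym_grp \<Omega>) base_perm"
    by (simp add: group_hom_def group_hom_axioms_def group_H group_sym_grp)
  from group_hom.img_is_subgroup[OF this] show ?thesis by simp
qed

lemma block_action_hom: "block_action blocks \<in> hom (perm_grp total H) (sym_grp blocks)"
proof (rule hom_sym_grpI[OF group_H])
  show "block_action blocks \<one>\<^bsub>perm_grp total H\<^esub> = id"
    by (simp add: block_action_def fun_eq_iff)
  show "block_action blocks h S = S" if "S \<notin> blocks" for h S
    using that by (simp add: block_action_def)
  show "block_action blocks (g \<otimes>\<^bsub>perm_grp total H\<^esub> h) = block_action blocks h \<circ> block_action blocks g"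
    if "g \<in> carrier (perm_grp total H)" "h \<in> carrier (perm_grp total H)" for g h
  proof
    fix S
    show "block_action blocks (g \<otimes>\<^bsub>perm_grp total H\<^esub> h) S = (block_action blocks h \<circ> block_action blocks g) S"
    proof (cases "S \<in> blocks")
      case True
      then have "g ` S \<in> blocks"
        using that(1) by (auto simp: image_fibre base_perm_in)
      then show ?thesis
        using True by (simp add: block_action_def image_comp)
    qed (simp add: block_action_def)
  qed
qed

lemma block_system_fibres: "block_system H total blocks"
  unfolding block_system_def
proof (intro conjI ballI)
  have "fibre \<omega> \<noteq> {}" for \<omega>
    by (simp add: fibre_def)
  then show "partition_on total blocks"
    using fibre_disjoint by (intro partition_onI) (auto simp: total_def disjnt_def)
next
  fix S assume S: "S \<in> blocks"
  then obtain \<omega> where \<omega>: "\<omega> \<in> \<Omega>" "S = fibre \<omega>" by auto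
  show "is_block H total S"
    unfolding is_block_def
  proof (intro conjI ballI)
    show "S \<subseteq> total" using \<omega> by (auto simp: total_def)
    show "h ` S = S \<or> h ` S \<inter> S = {}" if "h \<in> H" for h
      using that \<omega> fibre_disjoint[of "base_perm h \<omega>" \<omega>]
      by (cases "base_perm h \<omega> = \<omega>") (simp_all add: image_fibre base_perm_in)
  qed
next
  show "h ` S \<in> blocks" if "h \<in> H" "S \<in> blocks" for h S
    using that by (auto simp: image_fibre base_perm_in)
qed

subsection \<open>The kernel\<close>

text \<open>Fixing every fibre as a set means to have trivial base permutation, so an element of the
  kernel is determined by its shift vector.\<close>

lemma mem_kern_iff: "z \<in> kern \<longleftrightarrow> z \<in> H \<and> base_perm z = id"
proof -
  have "block_action blocks z = id \<longleftrightarrow> base_perm z = id" if z: "z \<in> H"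
  proof
    assume *: "block_action blocks z = id"
    show "base_perm z = id"
      by (rule ext) (simp add: base_perm_def pullback_perm_def * inj_on_fibre)
  next
    assume "base_perm z = id"
    then show "block_action blocks z = id"
      using image_fibre[OF z] by (auto simp: block_action_def fun_eq_iff)
  qed
  then show ?thesis
    by (auto simp: kern_def kernel_def)
qed

lemma kern_in_H: "z \<in> kern \<Longrightarrow> z \<in> H"
  by (simp add: mem_kern_iff)

lemma subgroup_kern: "subgroup kern (sym_grp total)"
proof -
  have "group_hom (perm_grp total H) (sym_grp blocks) (block_action blocks)"
    by (simp add: group_hom_def group_hom_axioms_def group_H group_sym_grp block_action_hom)
  then have "subgroup kern (perm_grp total H)"
    unfolding kern_def by (rule group_hom.subgroup_kernel)
  then show ?thesis
    unfolding perm_grp_def by (rule group.incl_subgroup[OF group_sym_grp subgroup_H])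
qed

lemmas kern_closed = subgroup_sym_grpD[OF subgroup_kern]

lemma group_kern: "group (perm_grp total kern)"
  by (rule group_perm_grp[OF subgroup_kern])

text \<open>Over the trivial base permutation the cocycle rule for shifts loses its twist and becomes
  addition of vectors.\<close>

lemma shift_kern_comp:
  assumes "z \<in> kern" "w \<in> kern"
  shows "shift (w \<circ> z) = (\<lambda>\<omega>\<in>\<Omega>. (shift z \<omega> + shift w \<omega>) mod int m)"
  using assms by (simp add: mem_kern_iff coords_comp)

lemma inj_on_shift_kern: "inj_on shift kern"
  using H_determined by (auto simp: inj_on_def mem_kern_iff)

lemma shift_kern_pow:
  assumes z: "z \<in> kern"
  shows "shift (z [^]\<^bsub>perm_grp total kern\<^esub> (n::nat)) = (\<lambda>\<omega>\<in>\<Omega>. (int n * shift z \<omega>) mod int m)"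
proof (induction n)
  case 0
  interpret group "perm_grp total kern" by (rule group_kern)
  show ?case by (simp only: nat_pow_0 perm_grp_simps coords_id) simp
next
  case (Suc n)
  interpret group "perm_grp total kern" by (rule group_kern)
  have "z [^]\<^bsub>perm_grp total kern\<^esub> n \<in> kern"
    using nat_pow_closed[of z n] z by simp
  moreover have "z [^]\<^bsub>perm_grp total kern\<^esub> Suc n = z \<circ> z [^]\<^bsub>perm_grp total kern\<^esub> n"
    by (simp only: nat_pow_Suc perm_grp_simps)
  ultimately have "shift (z [^]\<^bsub>perm_grp total kern\<^esub> Suc n)
      = (\<lambda>\<omega>\<in>\<Omega>. ((\<lambda>\<omega>\<in>\<Omega>. (int n * shift z \<omega>) mod int m) \<omega> + shift z \<omega>) mod int m)"
    using shift_kern_comp[OF _ z] Suc by metis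
  also have "\<dots> = (\<lambda>\<omega>\<in>\<Omega>. (int (Suc n) * shift z \<omega>) mod int m)"
    by (rule restrict_ext) (simp add: algebra_simps mod_simps)
  finally show ?case .
qed

lemma elementary_abelian_kern: "elementary_abelian m (perm_grp total kern)"
proof -
  interpret K: group "perm_grp total kern" by (rule group_kern)
  have "z \<circ> w = w \<circ> z" if "z \<in> kern" "w \<in> kern" for z w
  proof (rule inj_onD[OF inj_on_shift_kern])
    show "shift (z \<circ> w) = shift (w \<circ> z)"
      using that by (simp add: shift_kern_comp add.commute)
  qed (use that kern_closed in auto)
  then have "comm_group (perm_grp total kern)"
    by (intro K.group_comm_groupI) simp
  moreover have "z [^]\<^bsub>perm_grp total kern\<^esub> m = \<one>\<^bsub>perm_grp total kern\<^esub>" if z: "z \<in> kern" for z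
  proof (rule inj_onD[OF inj_on_shift_kern])
    show "shift (z [^]\<^bsub>perm_grp total kern\<^esub> m) = shift \<one>\<^bsub>perm_grp total kern\<^esub>"
      using z by (simp add: shift_kern_pow coords_id cong: restrict_cong)
    show "z [^]\<^bsub>perm_grp total kern\<^esub> m \<in> kern"
      using K.nat_pow_closed[of z m] z by simp
    show "\<one>\<^bsub>perm_grp total kern\<^esub> \<in> kern"
      using kern_closed by simp
  qed
  ultimately show ?thesis
    by (simp add: elementary_abelian_def)
qed

lemma order_kern_le: "Coset.order (perm_grp total kern) \<le> m ^ card \<Omega>"
proof -
  have "card kern \<le> card (\<Omega> \<rightarrow>\<^sub>E {0..<int m})"
    using shift_in kern_in_H finite_base
    by (intro card_inj_on_le[OF inj_on_shift_kern]) (auto intro: finite_PiE)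
  then show ?thesis
    using finite_base by (simp add: order_def card_PiE)
qed

subsection \<open>Embedding into the wreath product\<close>

lemma coords_mon:
  "(\<lambda>h. (shift h, base_perm h)) \<in>
    mon (perm_grp total H) (wreath_product (integer_mod_group m) \<Omega> (base_perm ` H))"
  using m_gt_1 shift_in
  by (auto simp: mon_def hom_def inj_on_def H_determined wreath_product_simps
      carrier_integer_mod_group coords_comp)

lemma embeds_in_wreath_product:
  "\<exists>S. subgroup S (wreath_product (integer_mod_group m) \<Omega> (base_perm ` H)) \<and>
     perm_grp total H \<cong> (wreath_product (integer_mod_group m) \<Omega> (base_perm ` H))\<lparr>carrier := S\<rparr>"
proof -
  let ?W = "wreath_product (integer_mod_group m) \<Omega> (base_perm ` H)"
  let ?c = "\<lambda>h. (shift h, base_perm h)"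
  have W: "group ?W"
    using subgroup_base by (intro group_wreath_product) simp_all
  have hom: "?c \<in> hom (perm_grp total H) ?W" and inj: "inj_on ?c H"
    using coords_mon by (simp_all add: mon_def)
  have "group_hom (perm_grp total H) ?W ?c"
    by (simp add: group_hom_def group_hom_axioms_def group_H W hom)
  from group_hom.img_is_subgroup[OF this] have "subgroup (?c ` H) ?W"
    by simp
  moreover have "?c \<in> iso (perm_grp total H) (?W\<lparr>carrier := ?c ` H\<rparr>)"
    using hom inj by (simp add: iso_def hom_def bij_betw_def)
  ultimately show ?thesis
    by (blast intro: is_isoI)
qed

subsection \<open>The kernel as a module\<close>

text \<open>In the shift of \<open>h\<^sup>-\<^sup>1 z h\<close> (in right-action order) the contributions of \<open>h\<^sup>-\<^sup>1\<close> and of \<open>h\<close> at a point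
  cancel, and only the entry of \<open>z\<close> remains, moved along by the base permutation of \<open>h\<close>.\<close>

lemma conj_kern:
  assumes h: "h \<in> H" and z: "z \<in> kern"
  shows "h \<circ> (z \<circ> inv_into UNIV h) \<in> kern"
    "shift (h \<circ> (z \<circ> inv_into UNIV h)) = perm_module_act \<Omega> (base_perm h) (shift z)"
proof -
  let ?s = "base_perm h"
  note zH = kern_in_H[OF z] and zid = conjunct2[OF z[unfolded mem_kern_iff]]
  have s: "?s permutes \<Omega>"
    using lies_overD(2)[OF lies[OF h]] .
  have i: "inv_into UNIV h \<in> H" and zi: "z \<circ> inv_into UNIV h \<in> H"
    using h zH H_closed by simp_all
  show "h \<circ> (z \<circ> inv_into UNIV h) \<in> kern"
    using h zi zid H_closed(3)[OF zi h] permutes_inv_o(1)[OF s]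
    by (simp add: mem_kern_iff coords_comp i zH coords_inv)
  have *: "inv_into UNIV ?s \<omega> \<in> \<Omega>" if "\<omega> \<in> \<Omega>" for \<omega>
    using that permutes_in_image[OF permutes_inv[OF s]] by simp
  have **: "inv_into \<Omega> ?s \<omega> = inv_into UNIV ?s \<omega>" if "\<omega> \<in> \<Omega>" for \<omega>
    using *[OF that] permutes_inverses(1)[OF s] permutes_inj_on[OF s]
    by (metis inv_into_f_f)
  show "shift (h \<circ> (z \<circ> inv_into UNIV h)) = perm_module_act \<Omega> ?s (shift z)"
    using shift_mod[OF zH]
    by (simp add: perm_module_act_def coords_comp[OF zi h] coords_comp[OF i zH] coords_inv[OF h]
        zid * ** mod_simps cong: restrict_cong)
qed

text \<open>Conjugation by any \<open>h\<close> that acts on the fibres as \<open>s\<close>. A representative is chosen; the next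
  lemma shows that all choices agree, because by \<open>conj_kern\<close> the shift vector of the result involves
  \<open>h\<close> only through its base permutation.\<close>

definition conj_action :: "('b set \<Rightarrow> 'b set) \<Rightarrow> ('b \<Rightarrow> 'b) \<Rightarrow> 'b \<Rightarrow> 'b" where
  "conj_action s z =
     (if z \<in> kern then
        (let h = inv_into H (block_action blocks) s in h \<circ> (z \<circ> inv_into UNIV h))
      else z)"

lemma conj_action_block_action:
  assumes h: "h \<in> H" and z: "z \<in> kern"
  shows "conj_action (block_action blocks h) z = h \<circ> (z \<circ> inv_into UNIV h)"
proof -
  let ?g = "inv_into H (block_action blocks) (block_action blocks h)"
  have g: "?g \<in> H" "block_action blocks ?g = block_action blocks h"
    using inv_into_into[OF imageI[OF h]] f_inv_into_f[OF imageI[OF h]] by blast+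
  then have "base_perm ?g = base_perm h"
    by (simp add: base_perm_def)
  then have "?g \<circ> (z \<circ> inv_into UNIV ?g) = h \<circ> (z \<circ> inv_into UNIV h)"
    using conj_kern[OF h z] conj_kern[OF g(1) z] by (intro inj_onD[OF inj_on_shift_kern]) simp_all
  then show ?thesis
    using z by (simp add: conj_action_def Let_def)
qed

lemma conj_action_hom:
  "conj_action \<in> hom (perm_grp blocks (block_action blocks ` H)) (sym_grp kern)"
proof (rule hom_sym_grpI)
  have "group_hom (perm_grp total H) (sym_grp blocks) (block_action blocks)"
    by (simp add: group_hom_def group_hom_axioms_def group_H group_sym_grp block_action_hom)
  from group_hom.img_is_subgroup[OF this]
  show "group (perm_grp blocks (block_action blocks ` H))"
    by (intro group_perm_grp) simp
  show "conj_action s z = z" if "z \<notin> kern" for s z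
    using that by (simp add: conj_action_def)
  have id: "block_action blocks id = id"
    by (simp add: block_action_def fun_eq_iff)
  show "conj_action \<one>\<^bsub>perm_grp blocks (block_action blocks ` H)\<^esub> = id"
  proof
    fix z
    show "conj_action \<one>\<^bsub>perm_grp blocks (block_action blocks ` H)\<^esub> z = id z"
      using conj_action_block_action[OF H_closed(2), of z] id
      by (cases "z \<in> kern") (simp_all add: conj_action_def)
  qed
  fix s t
  assume "s \<in> carrier (perm_grp blocks (block_action blocks ` H))"
    "t \<in> carrier (perm_grp blocks (block_action blocks ` H))"
  then obtain g h where gh: "g \<in> H" "s = block_action blocks g" "h \<in> H" "t = block_action blocks h"
    by auto
  have ts: "t \<circ> s = block_action blocks (h \<circ> g)"
    using block_action_hom gh by (simp add: hom_def)
  have "conj_action (t \<circ> s) z = conj_action t (conj_action s z)" for z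
  proof (cases "z \<in> kern")
    case True
    have "bij g" "bij h"
      using gh H_closed(1) permutes_bij by blast+
    then have "inv_into UNIV (h \<circ> g) = inv_into UNIV g \<circ> inv_into UNIV h"
      using o_inv_distrib by blast
    then show ?thesis
      unfolding ts unfolding gh
      using True gh conj_kern(1)[OF gh(1) True] H_closed(3)[OF gh(1,3)]
      by (simp add: conj_action_block_action comp_assoc)
  qed (simp add: conj_action_def)
  then show "conj_action (s \<otimes>\<^bsub>perm_grp blocks (block_action blocks ` H)\<^esub> t) = conj_action t \<circ> conj_action s"
    by (simp add: fun_eq_iff)
qed

lemma residue_ring_simps:
  "carrier (residue_ring (int m)) = {0..<int m}"
  "c \<otimes>\<^bsub>residue_ring (int m)\<^esub> d = (c * d) mod int m"
  "c \<oplus>\<^bsub>residue_ring (int m)\<^esub> d = (c + d) mod int m"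
proof -
  have "{0..int m - 1} = {0..<int m}" by auto
  then show "carrier (residue_ring (int m)) = {0..<int m}"
    by (simp add: residue_ring_def)
qed (simp_all add: residue_ring_def)

lemma smult_shift:
  assumes "c \<in> carrier (residue_ring (int m))" "z \<in> kern"
  shows "shift (z [^]\<^bsub>perm_grp total kern\<^esub> c)
    = c \<odot>\<^bsub>perm_module (residue_ring (int m)) \<Omega>\<^esub> shift z"
proof -
  have "0 \<le> c"
    using assms(1) by (simp add: residue_ring_simps)
  then have "z [^]\<^bsub>perm_grp total kern\<^esub> c = z [^]\<^bsub>perm_grp total kern\<^esub> nat c"
    by (intro pow_nat[symmetric])
  then have "shift (z [^]\<^bsub>perm_grp total kern\<^esub> c) = (\<lambda>\<omega>\<in>\<Omega>. (int (nat c) * shift z \<omega>) mod int m)"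
    using shift_kern_pow[OF assms(2)] by metis
  then show ?thesis
    using \<open>0 \<le> c\<close> by (simp add: perm_module_simps residue_ring_simps)
qed

text \<open>The shift vectors of the kernel form the image of a homomorphism into the additive group of
  the permutation module, and a scalar multiple is the shift vector of a power.\<close>

lemma shift_submodule:
  "submodule (shift ` kern) (residue_ring (int m)) (perm_module (residue_ring (int m)) \<Omega>)"
proof -
  let ?M = "perm_module (residue_ring (int m)) \<Omega>"
  have R: "residues (int m)"
    using m_gt_1 by (intro residues.intro) simp
  interpret K: group "perm_grp total kern" by (rule group_kern)
  have "shift \<in> hom (perm_grp total kern) (add_monoid ?M)"
    using shift_in kern_in_H
    by (simp add: hom_def perm_module_simps residue_ring_simps shift_kern_comp Pi_iff)
  then have "group_hom (perm_grp total kern) (add_monoid ?M) shift"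
    by (simp add: group_hom_def group_hom_axioms_def group_kern group_perm_module residues.abelian_group[OF R])
  from group_hom.img_is_subgroup[OF this] have "subgroup (shift ` kern) (add_monoid ?M)"
    by simp
  moreover have "c \<odot>\<^bsub>?M\<^esub> v \<in> shift ` kern"
    if c: "c \<in> carrier (residue_ring (int m))" and v: "v \<in> shift ` kern" for c v
  proof -
    obtain z where "z \<in> kern" "v = shift z" using v by auto
    then show ?thesis
      using imageI[OF K.int_pow_closed[of z c, simplified], of shift] smult_shift[OF c, of z] by simp
  qed
  ultimately show ?thesis
    by (simp add: submodule_def submodule_axioms_def)
qed

lemma shift_conj_action:
  assumes "s \<in> block_action blocks ` H" "z \<in> kern"
  shows "conj_action s z \<in> kern"
    "shift (conj_action s z) = perm_module_act \<Omega> (pullback_perm \<Omega> fibre s) (shift z)"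
proof -
  obtain h where h: "s = block_action blocks h" "h \<in> H"
    using assms(1) by (rule imageE)
  show "conj_action s z \<in> kern"
    unfolding h(1) conj_action_block_action[OF h(2) assms(2)] by (rule conj_kern(1)[OF h(2) assms(2)])
  show "shift (conj_action s z) = perm_module_act \<Omega> (pullback_perm \<Omega> fibre s) (shift z)"
    unfolding h(1) conj_action_block_action[OF h(2) assms(2)] conj_kern(2)[OF h(2) assms(2)]
      base_perm_def by simp
qed

lemma shift_image_invariant:
  assumes "s \<in> block_action blocks ` H" "v \<in> shift ` kern"
  shows "perm_module_act \<Omega> (pullback_perm \<Omega> fibre s) v \<in> shift ` kern"
proof -
  obtain z where z: "v = shift z" "z \<in> kern"
    using assms(2) by (rule imageE)
  show ?thesis
    unfolding z(1) shift_conj_action(2)[OF assms(1) z(2), symmetric]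
    by (rule imageI) (rule shift_conj_action(1)[OF assms(1) z(2)])
qed

lemma shift_module_iso:
  "module_iso (residue_ring (int m)) (power_module (perm_grp total kern))
     ((perm_module (residue_ring (int m)) \<Omega>)\<lparr>carrier := shift ` kern\<rparr>) shift"
  unfolding module_iso_def
proof (intro conjI ballI)
  let ?M = "perm_module (residue_ring (int m)) \<Omega>"
  show "bij_betw shift (carrier (power_module (perm_grp total kern)))
      (carrier (?M\<lparr>carrier := shift ` kern\<rparr>))"
    using inj_on_shift_kern by (simp add: power_module_def bij_betw_def)
next
  let ?M = "perm_module (residue_ring (int m)) \<Omega>"
  fix v w
  assume "v \<in> carrier (power_module (perm_grp total kern))"
    "w \<in> carrier (power_module (perm_grp total kern))"
  then show "shift (v \<oplus>\<^bsub>power_module (perm_grp total kern)\<^esub> w)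
      = shift v \<oplus>\<^bsub>?M\<lparr>carrier := shift ` kern\<rparr>\<^esub> shift w"
    by (simp add: power_module_def perm_module_def residue_ring_simps shift_kern_comp)
next
  let ?M = "perm_module (residue_ring (int m)) \<Omega>"
  fix c v
  assume "c \<in> carrier (residue_ring (int m))" "v \<in> carrier (power_module (perm_grp total kern))"
  then show "shift (c \<odot>\<^bsub>power_module (perm_grp total kern)\<^esub> v)
      = c \<odot>\<^bsub>?M\<lparr>carrier := shift ` kern\<rparr>\<^esub> shift v"
    using smult_shift[of c v] by (simp add: power_module_def perm_module_def)
qed

subsection \<open>Transitive groups\<close>

text \<open>The element \<open>t\<close> moves through the whole fibre over \<open>a\<close> in unit steps, and the other fibres are
  reached from that one by transitivity of the base group.\<close>

lemma transitiveI:
  assumes a: "a \<in> \<Omega>" and base: "\<And>\<omega>. \<omega> \<in> \<Omega> \<Longrightarrow> \<exists>h\<in>H. base_perm h a = \<omega>"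
    and t: "t \<in> H" "\<And>i. t (e a i) = e a (i + 1)"
  shows "transitive_on H total"
proof -
  have pow: "t ^^ n \<in> H \<and> (t ^^ n) (e a 0) = e a (int n)" for n
  proof (induction n)
    case 0
    have "t ^^ 0 = id"
      by (rule ext) simp
    then show ?case
      using H_closed(2) by (metis id_apply of_nat_0)
  next
    case (Suc n)
    have "t ^^ Suc n = t \<circ> t ^^ n"
      by (rule funpow.simps)
    moreover have "t \<circ> t ^^ n \<in> H"
      using H_closed(3)[of "t ^^ n" t] Suc t(1) by blast
    moreover have "(t \<circ> t ^^ n) (e a 0) = e a (int (Suc n))"
      using Suc t(2)[of "int n"] by (simp add: add.commute)
    ultimately show ?case by metis
  qed
  have reach: "\<exists>g\<in>H. g (e a 0) = u" if u_in: "u \<in> total" for u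
  proof -
    obtain \<omega> i where u: "\<omega> \<in> \<Omega>" "u = e \<omega> i"
      using u_in by (rule totalE)
    obtain h where h: "h \<in> H" "base_perm h a = \<omega>"
      using base[OF u(1)] by blast
    let ?n = "nat ((i - shift h a) mod int m)"
    have "h ((t ^^ ?n) (e a 0)) = e \<omega> (int ?n + shift h a)"
      using pow[of ?n] lies_overD(4)[OF lies[OF h(1)] a] h(2) by simp
    also have "\<dots> = u"
      unfolding u(2) using u(1) m_gt_1 by (intro point_cong) (simp_all add: mod_simps)
    finally show ?thesis
      using H_closed(3)[of "t ^^ ?n" h] pow h(1) by (intro bexI[of _ "h \<circ> t ^^ ?n"]) auto
  qed
  show ?thesis
    unfolding transitive_on_def
  proof (intro ballI)
    fix u v
    assume "u \<in> total" "v \<in> total"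
    then obtain g h where gh: "g \<in> H" "g (e a 0) = u" "h \<in> H" "h (e a 0) = v"
      using reach by meson
    have "inv_into UNIV g u = e a 0"
      using gh(2) permutes_inverses(2)[OF H_closed(1)[OF gh(1)]] by metis
    then show "\<exists>k\<in>H. k u = v"
      using gh H_closed(3)[OF H_closed(4)[OF gh(1)] gh(3)]
      by (intro bexI[of _ "h \<circ> inv_into UNIV g"]) auto
  qed
qed

text \<open>An element that preserves a fibre rotates it by its shift there. Transitivity supplies every
  rotation: an element taking point 0 of the fibre to point \<open>j\<close> must preserve the fibre and
  rotate it by \<open>j\<close>.\<close>

lemma induced_perms_eq_rotations:
  assumes trans: "transitive_on H total" and \<omega>: "\<omega> \<in> \<Omega>"
  shows "induced_perms (setwise_stab H (fibre \<omega>)) (fibre \<omega>) = rotation \<omega> ` {0..<int m}"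
proof -
  let ?r = "\<lambda>h u. if u \<in> fibre \<omega> then h u else u"
  have eq: "?r h = rotation \<omega> (shift h \<omega>)" if "h \<in> H" "base_perm h \<omega> = \<omega>" for h
  proof
    fix u
    show "?r h u = rotation \<omega> (shift h \<omega>) u"
      using lies_overD(4)[OF lies[OF that(1)] \<omega>] that(2) \<omega>
      by (cases "u \<in> fibre \<omega>") (auto simp: fibre_def rotation_point rotation_outside)
  qed
  have "h ` fibre \<omega> = fibre \<omega> \<longleftrightarrow> base_perm h \<omega> = \<omega>" if "h \<in> H" for h
    unfolding image_fibre[OF that \<omega>] using that \<omega> by (intro fibre_eq_iff) (simp_all add: base_perm_in)
  then have stab: "setwise_stab H (fibre \<omega>) = {h \<in> H. base_perm h \<omega> = \<omega>}"
    unfolding setwise_stab_def by blast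
  show ?thesis
  proof
    show "induced_perms (setwise_stab H (fibre \<omega>)) (fibre \<omega>) \<subseteq> rotation \<omega> ` {0..<int m}"
    proof
      fix g
      assume "g \<in> induced_perms (setwise_stab H (fibre \<omega>)) (fibre \<omega>)"
      then obtain h where h: "h \<in> H" "base_perm h \<omega> = \<omega>" "g = ?r h"
        unfolding induced_perms_def stab by blast
      then have "g = rotation \<omega> (shift h \<omega>)"
        using eq by simp
      then show "g \<in> rotation \<omega> ` {0..<int m}"
        using PiE_mem[OF shift_in[OF h(1)] \<omega>] by blast
    qed
    show "rotation \<omega> ` {0..<int m} \<subseteq> induced_perms (setwise_stab H (fibre \<omega>)) (fibre \<omega>)"
    proof
      fix g
      assume "g \<in> rotation \<omega> ` {0..<int m}"
      then obtain j where j: "g = rotation \<omega> j" by auto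
      obtain h where h: "h \<in> H" "h (e \<omega> 0) = e \<omega> j"
        using trans \<omega> point_in_total unfolding transitive_on_def by meson
      have "e (base_perm h \<omega>) (0 + shift h \<omega>) = e \<omega> j"
        using lies_overD(4)[OF lies[OF h(1)] \<omega>] h(2) by metis
      then have *: "base_perm h \<omega> = \<omega>" "shift h \<omega> mod int m = j mod int m"
        using \<omega> h(1) base_perm_in by (simp_all add: point_eq_iff)
      then have "g = ?r h"
        using eq[OF h(1)] rotation_eq_iff[OF \<omega>] j by simp
      then show "g \<in> induced_perms (setwise_stab H (fibre \<omega>)) (fibre \<omega>)"
        unfolding induced_perms_def stab using h(1) * by blast
    qed
  qed
qed

lemma induced_perms_cyclic:
  assumes "transitive_on H total" and \<omega>: "\<omega> \<in> \<Omega>"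
  defines "Q \<equiv> induced_perms (setwise_stab H (fibre \<omega>)) (fibre \<omega>)"
  shows "subgroup Q (sym_grp total)" "cyclic_group (perm_grp total Q)"
    "Coset.order (perm_grp total Q) = m"
proof -
  have c: "carrier (integer_mod_group m) = {0..<int m}"
    using m_gt_1 by (simp add: carrier_integer_mod_group)
  have Q: "Q = rotation \<omega> ` carrier (integer_mod_group m)"
    unfolding Q_def c by (rule induced_perms_eq_rotations[OF assms(1,2)])
  have hom: "rotation \<omega> \<in> hom (integer_mod_group m) (sym_grp total)"
    and inj: "inj_on (rotation \<omega>) {0..<int m}"
    using rotation_mon[OF \<omega>] by (simp_all add: mon_def c)
  then have "group_hom (integer_mod_group m) (sym_grp total) (rotation \<omega>)"
    by (simp add: group_hom_def group_hom_axioms_def group_sym_grp)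
  then show sub: "subgroup Q (sym_grp total)"
    unfolding Q by (rule group_hom.img_is_subgroup)
  have "rotation \<omega> j \<in> Q" for j
    unfolding Q c using m_gt_1 rotation_eq_iff[OF \<omega>, of j "j mod int m"]
    by (intro image_eqI[of _ _ "j mod int m"]) simp_all
  then have "rotation \<omega> \<in> epi integer_group (perm_grp total Q)"
    using Q rotation_comp[OF \<omega>] by (auto simp: epi_def hom_def)
  then show "cyclic_group (perm_grp total Q)"
    by (rule group.cyclic_group_epimorphic_image[OF group_integer_group])
      (simp_all add: group_perm_grp[OF sub])
  show "Coset.order (perm_grp total Q) = m"
    using card_image[OF inj] by (simp add: order_def Q c)
qed

lemma imprimitive_fibres:
  assumes "transitive_on H total" "a \<in> \<Omega>" "b \<in> \<Omega>" "a \<noteq> b"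
  shows "imprimitive_with_blocks H total blocks"
  unfolding imprimitive_with_blocks_def
proof (intro conjI ballI)
  fix S
  assume "S \<in> blocks"
  then obtain \<omega> where \<omega>: "\<omega> \<in> \<Omega>" "S = fibre \<omega>" by auto
  obtain \<omega>' where \<omega>': "\<omega>' \<in> \<Omega>" "\<omega>' \<noteq> \<omega>"
    using assms by metis
  have "e \<omega>' 0 \<in> total" "e \<omega>' 0 \<notin> S"
    using \<omega> \<omega>' by (auto simp: point_in_total fibre_def point_eq_iff)
  then show "S \<noteq> total" by auto
  have "e \<omega> 0 \<in> S" "e \<omega> 1 \<in> S" "e \<omega> 0 \<noteq> e \<omega> 1"
    using \<omega> m_gt_1 by (auto simp: fibre_def point_eq_iff)
  then show "\<not> is_singleton S"
    by (metis is_singletonE singletonD)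
qed (use assms block_system_fibres in auto)

end

section \<open>Composition along a handle\<close>

theorem theorem4p1:
  fixes p q r n :: nat and k :: int
    and \<Omega> :: "'a set" and \<Omega>s :: "nat \<Rightarrow> 'b set"
    and \<pi> :: "(triangle_gen \<times> bool) list set \<Rightarrow> 'a \<Rightarrow> 'a"
    and \<pi>s :: "nat \<Rightarrow> (triangle_gen \<times> bool) list set \<Rightarrow> 'b \<Rightarrow> 'b"
    and \<phi> :: "(triangle_gen \<times> bool) list set \<Rightarrow> 'b \<Rightarrow> 'b"
    and f :: "nat \<Rightarrow> 'a \<Rightarrow> 'b" and a b :: 'a
  assumes p: "Factorial_Ring.prime p"
    and G: "G = triangle_group p q r" "x = triangle_x p q r" "y = triangle_y p q r"
    and \<Omega>: "finite \<Omega>" "card \<Omega> = n"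
    and \<pi>: "perm_rep G \<Omega> \<pi>"
    and \<Omega>s: "\<And>i. i \<in> {1..p} \<Longrightarrow> finite (\<Omega>s i)" "disjoint_family_on \<Omega>s {1..p}"
    and \<pi>s: "\<And>i. i \<in> {1..p} \<Longrightarrow> perm_rep G (\<Omega>s i) (\<pi>s i)"
            "\<And>i. i \<in> {1..p} \<Longrightarrow> transitive_on (\<pi>s i ` carrier G) (\<Omega>s i)"
            "\<And>i. i \<in> {1..p} \<Longrightarrow> equivalent_via G \<Omega> \<pi> (\<Omega>s i) (\<pi>s i) (f i)"
    and handle: "is_handle p q r \<Omega> \<pi> k a b"
    and U: "U = (\<Union>i\<in>{1..p}. \<Omega>s i)"
    and \<phi>: "perm_rep G U \<phi>"
    and \<phi>_x: "\<phi> x = list_prod (sym_grp U) (map (\<lambda>i. \<pi>s i x) [1..<Suc p])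
                      \<otimes>\<^bsub>sym_grp U\<^esub> cycle_of_list (map (\<lambda>i. f i a) [1..<Suc p])
                      \<otimes>\<^bsub>sym_grp U\<^esub> cycle_of_list (map (\<lambda>i. f i b) (rev [1..<Suc p]))"
    and \<phi>_y: "\<phi> y = list_prod (sym_grp U) (map (\<lambda>i. \<pi>s i y) [1..<Suc p])"
    and B: "B = (\<lambda>\<omega>. (\<lambda>i. f i \<omega>) ` {1..p})"
    and \<B>: "\<B> = B ` \<Omega>"
    and H: "H = \<phi> ` carrier G"
    and \<psi>: "\<psi> = block_action \<B>"
    and N: "N = kernel (perm_grp U H) (sym_grp \<B>) \<psi>"
    and J: "J = (\<lambda>\<omega>. setwise_stab H (B \<omega>))"
    and Q: "Q = (\<lambda>\<omega>. induced_perms (J \<omega>) (B \<omega>))"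
    and \<tau>: "\<tau> = pullback_perm \<Omega> B"
  shows
    "\<comment> \<open>(i)\<close>
     (\<psi> \<in> hom (perm_grp U H) (sym_grp \<B>) \<and>
      equivalent_via G \<Omega> \<pi> \<B> (\<lambda>g. \<psi> (\<phi> g)) B)
     \<and>
     \<comment> \<open>(ii)\<close>
     imprimitive_with_blocks H U \<B>
     \<and>
     \<comment> \<open>(iii)\<close>
     ((\<forall>\<omega>\<in>\<Omega>. subgroup (Q \<omega>) (sym_grp U) \<and>
               cyclic_group (perm_grp U (Q \<omega>)) \<and> Coset.order (perm_grp U (Q \<omega>)) = p) \<and>
      elementary_abelian p (perm_grp U N) \<and> Coset.order (perm_grp U N) \<le> p ^ n)
     \<and>
     \<comment> \<open>(iv)\<close>
     ((\<exists>S. subgroup S (wreath_product (integer_mod_group p) \<Omega> (\<tau> ` \<psi> ` H)) \<and>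
           perm_grp U H \<cong> (wreath_product (integer_mod_group p) \<Omega> (\<tau> ` \<psi> ` H))\<lparr>carrier := S\<rparr>) \<and>
      (\<exists>\<alpha>. \<alpha> \<in> hom (perm_grp \<B> (\<psi> ` H)) (sym_grp N) \<and>
           (\<forall>h\<in>H. \<forall>z\<in>N. \<alpha> (\<psi> h) z =
              inv\<^bsub>perm_grp U H\<^esub> h \<otimes>\<^bsub>perm_grp U H\<^esub> z \<otimes>\<^bsub>perm_grp U H\<^esub> h) \<and>
           (\<exists>W \<theta>. submodule W (residue_ring (int p)) (perm_module (residue_ring (int p)) \<Omega>) \<and>
              (\<forall>s\<in>\<psi> ` H. \<forall>v\<in>W. perm_module_act \<Omega> (\<tau> s) v \<in> W) \<and>
              module_iso (residue_ring (int p)) (power_module (perm_grp U N))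
                ((perm_module (residue_ring (int p)) \<Omega>)\<lparr>carrier := W\<rparr>) \<theta> \<and>
              (\<forall>s\<in>\<psi> ` H. \<forall>z\<in>N. \<theta> (\<alpha> s z) = perm_module_act \<Omega> (\<tau> s) (\<theta> z)))))"
proof -
  have p1: "1 < p" using p by (rule prime_gt_1_nat)
  have grp: "group G"
    unfolding G triangle_group_def by (rule group_presented_group)

  \<comment> \<open>The copies of \<open>\<Omega>\<close> are numbered 1 to \<open>p\<close>, so residue 0 stands for copy 1.\<close>
  define e where "e = (\<lambda>\<omega> i. f (Suc (nat (i mod int p))) \<omega>)"
  have bij: "bij_betw (f i) \<Omega> (\<Omega>s i)"
    and equiv: "\<And>\<omega> g. \<omega> \<in> \<Omega> \<Longrightarrow> g \<in> carrier G \<Longrightarrow> f i (\<pi> g \<omega>) = \<pi>s i g (f i \<omega>)"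
    if "i \<in> {1..p}" for i
    using \<pi>s(3)[OF that] by (auto simp: equivalent_via_def)
  have index: "Suc (nat (i mod int p)) \<in> {1..p}" for i
    using p1 by (simp add: Suc_le_eq nat_less_iff)
  have e_in: "e \<omega> i \<in> \<Omega>s (Suc (nat (i mod int p)))" if "\<omega> \<in> \<Omega>" for \<omega> i
    using bij_betwE[OF bij[OF index]] that by (simp add: e_def)
  interpret cyclic_cover p \<Omega> e
  proof
    fix \<omega> \<omega>' :: 'a and i j :: int
    assume \<omega>: "\<omega> \<in> \<Omega>" "\<omega>' \<in> \<Omega>"
    show "e \<omega> i = e \<omega>' j \<longleftrightarrow> \<omega> = \<omega>' \<and> i mod int p = j mod int p"
    proof
      assume eq: "e \<omega> i = e \<omega>' j"
      then have "Suc (nat (i mod int p)) = Suc (nat (j mod int p))"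
        using e_in[OF \<omega>(1), of i] e_in[OF \<omega>(2), of j] \<Omega>s(2) index
        unfolding disjoint_family_on_def by (metis disjoint_iff)
      moreover from this have "i mod int p = j mod int p"
        using p1 by (simp add: eq_nat_nat_iff)
      ultimately show "\<omega> = \<omega>' \<and> i mod int p = j mod int p"
        using eq \<omega> bij_betw_imp_inj_on[OF bij[OF index]] by (auto simp: e_def inj_on_def)
    qed (simp add: e_def)
  qed (use p1 \<Omega> in auto)
  have f_eq: "f i \<omega> = e \<omega> (int i - 1)" if "i \<in> {1..p}" for i \<omega>
    using that by (simp add: e_def nat_diff_distrib)
  have fibre: "fibre = B"
  proof
    fix \<omega>
    show "fibre \<omega> = B \<omega>"
      unfolding fibre_def B
    proof
      show "range (e \<omega>) \<subseteq> (\<lambda>i. f i \<omega>) ` {1..p}"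
        unfolding e_def using index by blast
      show "(\<lambda>i. f i \<omega>) ` {1..p} \<subseteq> range (e \<omega>)"
        using f_eq by blast
    qed
  qed
  have total: "total = U"
  proof
    show "total \<subseteq> U"
    proof
      fix u
      assume "u \<in> total"
      then show "u \<in> U"
        unfolding U by (rule totalE) (use e_in index in blast)
    qed
    show "U \<subseteq> total"
    proof
      fix u
      assume "u \<in> U"
      then obtain i where i: "i \<in> {1..p}" "u \<in> \<Omega>s i"
        unfolding U by blast
      then have "u \<in> f i ` \<Omega>"
        using bij_betw_imp_surj_on[OF bij[OF i(1)]] by simp
      then obtain \<omega> where "\<omega> \<in> \<Omega>" "u = f i \<omega>"
        by blast
      then show "u \<in> total" using f_eq[OF i(1)] point_in_total by simp
    qed
  qed

  have a: "a \<in> \<Omega>" "\<pi> x a = a" and b: "b \<in> \<Omega>" and ab: "a \<noteq> b"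
    using handle by (auto simp: is_handle_def G)
  interpret \<phi>: group_hom G "sym_grp U" \<phi>
    using \<phi> by (simp add: group_hom_def group_hom_axioms_def grp group_sym_grp perm_rep_def)
  interpret \<pi>: group_hom G "sym_grp \<Omega>" \<pi>
    using \<pi> by (simp add: group_hom_def group_hom_axioms_def grp group_sym_grp perm_rep_def)
  have xy: "x \<in> carrier G" "y \<in> carrier G"
    by (auto simp: G triangle_group_def triangle_x_def triangle_y_def presented_group_def)
  have \<pi>_in: "\<pi> g \<omega> \<in> \<Omega> \<longleftrightarrow> \<omega> \<in> \<Omega>" if "g \<in> carrier G" for g \<omega>
    using \<pi>.hom_closed[OF that] by (simp add: permutes_in_image)

  have prod: "list_prod (sym_grp U) (map (\<lambda>i. \<pi>s i g) [1..<Suc p]) (e \<omega> i) = e (\<pi> g \<omega>) i"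
    if g: "g \<in> carrier G" and \<omega>: "\<omega> \<in> \<Omega>" for g \<omega> i
  proof -
    have set: "set [1..<Suc p] = {1..p}" by auto
    have "list_prod (sym_grp U) (map (\<lambda>i. \<pi>s i g) [1..<Suc p]) (e \<omega> i)
        = \<pi>s (Suc (nat (i mod int p))) g (e \<omega> i)"
    proof (rule list_prod_disjoint[where A = \<Omega>s])
      show "\<pi>s l g permutes \<Omega>s l" if "l \<in> set [1..<Suc p]" for l
        using \<pi>s(1)[of l] g that by (auto simp: perm_rep_def hom_def)
    qed (use \<Omega>s(2) index e_in[OF \<omega>] in \<open>simp_all only: set distinct_upt\<close>)
    then show ?thesis
      using equiv[OF index \<omega> g] by (simp add: e_def)
  qed
  have upt: "[1..<Suc p] = map Suc [0..<p]"
    by (simp add: map_Suc_upt)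
  have cycle_a: "cycle_of_list (map (\<lambda>i. f i a) [1..<Suc p]) = rotation a 1"
  proof -
    have "map (\<lambda>i. f i a) [1..<Suc p] = map (\<lambda>k. e a (0 + 1 * int k)) [0..<p]"
      unfolding upt by (simp add: f_eq)
    then show ?thesis
      using cycle_eq_rotation[OF a(1), of 1 0] by simp
  qed
  have cycle_b: "cycle_of_list (map (\<lambda>i. f i b) (rev [1..<Suc p])) = rotation b (- 1)"
  proof -
    have "map (\<lambda>i. f i b) (rev [1..<Suc p]) = map (\<lambda>k. e b (int p - 1 + - 1 * int k)) [0..<p]"
      by (rule nth_equalityI) (simp_all add: rev_nth f_eq algebra_simps del: upt_Suc)
    then show ?thesis
      using cycle_eq_rotation[OF b, of "- 1" "int p - 1"] by simp
  qed
  \<comment> \<open>The two cycles inserted along the handle change the copy only over \<open>a\<close> and \<open>b\<close>.\<close>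
  have \<phi>_x_point: "\<phi> x (e \<omega> i)
      = e (\<pi> x \<omega>) (i + ((if \<pi> x \<omega> = a then 1 else 0) + (if \<pi> x \<omega> = b then - 1 else 0)))"
    if "\<omega> \<in> \<Omega>" for \<omega> i
  proof -
    have "\<phi> x (e \<omega> i) = rotation b (- 1) (rotation a 1 (e (\<pi> x \<omega>) i))"
      unfolding \<phi>_x cycle_a cycle_b by (simp only: sym_grp_simps comp_apply prod[OF xy(1) that])
    then show ?thesis
      using that a b \<pi>_in[OF xy(1)] by (simp add: rotation_point add.assoc)
  qed
  have \<phi>_y_point: "\<phi> y (e \<omega> i) = e (\<pi> y \<omega>) (i + 0)" if "\<omega> \<in> \<Omega>" for \<omega> i
    unfolding \<phi>_y using prod[OF xy(2) that] by simp

  \<comment> \<open>Having coordinates with base permutation \<open>\<pi> g\<close> is inherited by products and inverses, so it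
    suffices to check it for the two generators.\<close>
  define K where "K = {g \<in> carrier G. \<exists>c. lies_over (\<phi> g) c (\<pi> g)}"
  have "subgroup K G"
  proof (rule subgroup.intro)
    show "K \<subseteq> carrier G" by (auto simp: K_def)
    show "\<one>\<^bsub>G\<^esub> \<in> K"
      using lies_over_id \<phi>.hom_one \<pi>.hom_one by (auto simp: K_def)
    show "g \<otimes>\<^bsub>G\<^esub> h \<in> K" if "g \<in> K" "h \<in> K" for g h
      using that lies_over_comp by (fastforce simp: K_def)
    show "inv\<^bsub>G\<^esub> g \<in> K" if "g \<in> K" for g
    proof -
      have g: "g \<in> carrier G" using that by (simp add: K_def)
      have "\<phi> (inv\<^bsub>G\<^esub> g) = inv_into UNIV (\<phi> g)" "\<pi> (inv\<^bsub>G\<^esub> g) = inv_into UNIV (\<pi> g)"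
        using \<phi>.hom_inv[OF g] \<pi>.hom_inv[OF g] \<phi>.hom_closed[OF g] \<pi>.hom_closed[OF g]
        by (simp_all add: inv_sym_grp)
      then show ?thesis
        using that lies_over_inv by (fastforce simp: K_def)
    qed
  qed
  moreover have "x \<in> K"
    using xy(1) \<phi>.hom_closed[OF xy(1)] \<pi>.hom_closed[OF xy(1)] lies_overI[OF _ _ \<phi>_x_point]
    by (auto simp: K_def total)
  moreover have "y \<in> K"
    using xy(2) \<phi>.hom_closed[OF xy(2)] \<pi>.hom_closed[OF xy(2)] lies_overI[OF _ _ \<phi>_y_point]
    by (auto simp: K_def total)
  ultimately have "K = carrier G"
    unfolding G triangle_group_def triangle_x_def triangle_y_def
  proof (intro presented_group_eq_of_generators)
    fix g
    assume "pres_class (triangle_relators p q r) [(Gen_x, True)] \<in> K"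
      "pres_class (triangle_relators p q r) [(Gen_y, True)] \<in> K"
    then show "pres_class (triangle_relators p q r) [(g, True)] \<in> K"
      by (cases g) simp_all
  qed
  then have lies_\<phi>: "\<exists>c. lies_over (\<phi> g) c (\<pi> g)" if "g \<in> carrier G" for g
    using that by (auto simp: K_def)
  then have base_\<phi>: "base_perm (\<phi> g) = \<pi> g" if "g \<in> carrier G" for g
    using that base_perm_eq by blast

  interpret fibre_preserving_group p \<Omega> e H
  proof (rule fibre_preserving_group.intro[OF cyclic_cover_axioms fibre_preserving_group_axioms.intro])
    show "subgroup H (sym_grp total)"
      unfolding H total by (rule \<phi>.img_is_subgroup)
    show "\<exists>c s. lies_over h c s" if "h \<in> H" for h
      using that lies_\<phi> by (auto simp: H)
  qed
  have blocks: "blocks = \<B>"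
    by (simp add: \<B> fibre)
  have kern: "kern = N"
    by (simp add: kern_def N \<psi> blocks total)
  have base_image: "base_perm ` H = \<tau> ` \<psi> ` H"
    by (simp add: base_perm_def fibre \<tau> \<psi> \<B> image_image)

  have trans: "transitive_on H total"
  proof (rule transitiveI[OF a(1)])
    show "\<phi> x \<in> H" using xy by (simp add: H)
    \<comment> \<open>As \<open>\<pi> x\<close> fixes \<open>a\<close> and \<open>b \<noteq> a\<close>, the net effect over \<open>a\<close> is a rotation by one step.\<close>
    show "\<phi> x (e a i) = e a (i + 1)" for i
      using \<phi>_x_point[OF a(1)] a ab by simp
    show "\<exists>h\<in>H. base_perm h a = \<omega>" if \<omega>: "\<omega> \<in> \<Omega>" for \<omega>
    proof -
      have 1: "1 \<in> {1..p}" using p1 by simp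
      have "f 1 a \<in> \<Omega>s 1" "f 1 \<omega> \<in> \<Omega>s 1"
        using bij_betwE[OF bij[OF 1]] a \<omega> by auto
      then obtain g where g: "g \<in> carrier G" "\<pi>s 1 g (f 1 a) = f 1 \<omega>"
        using \<pi>s(2)[OF 1] unfolding transitive_on_def by blast
      then have "f 1 (\<pi> g a) = f 1 \<omega>"
        using equiv[OF 1 a(1)] by simp
      then have "\<pi> g a = \<omega>"
        using bij_betw_imp_inj_on[OF bij[OF 1]] \<omega> a \<pi>_in[OF g(1)] by (simp add: inj_on_def)
      then show ?thesis
        using g base_\<phi> by (auto simp: H)
    qed
  qed

  have "equivalent_via G \<Omega> \<pi> \<B> (\<lambda>g. \<psi> (\<phi> g)) B"
    unfolding equivalent_via_def
  proof (intro conjI ballI)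
    show "bij_betw B \<Omega> \<B>"
      using inj_on_fibre by (simp add: bij_betw_def \<B> fibre)
    show "B (\<pi> g \<omega>) = \<psi> (\<phi> g) (B \<omega>)" if "\<omega> \<in> \<Omega>" "g \<in> carrier G" for \<omega> g
      using image_fibre[of "\<phi> g" \<omega>] that
      by (simp add: \<psi> block_action_def \<B> base_\<phi> H fibre)
  qed
  moreover have "inv\<^bsub>perm_grp U H\<^esub> h \<otimes>\<^bsub>perm_grp U H\<^esub> z \<otimes>\<^bsub>perm_grp U H\<^esub> h = conj_action (\<psi> h) z"
    if "h \<in> H" "z \<in> N" for h z
    using that inv_perm_grp[OF subgroup_H that(1)]
    by (simp add: conj_action_block_action kern \<psi> total flip: blocks)
  ultimately show ?thesis
    using block_action_hom imprimitive_fibres[OF trans a(1) b ab] induced_perms_cyclic[OF trans]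
      elementary_abelian_kern order_kern_le embeds_in_wreath_product conj_action_hom
      shift_submodule shift_image_invariant shift_module_iso shift_conj_action(2)
    unfolding kern fibre total base_image Q J \<Omega>(2) \<B>[symmetric] \<psi>[symmetric] \<tau>[symmetric]
    by (intro conjI exI[of _ conj_action] exI[of _ "shift ` N"] exI[of _ shift] ballI) simp_all
qed

end
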